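(* Let $d\ge 1$ be an integer, let $\boldsymbol{M}=(M_1,\dots,M_d)$ be such that $\mathcal{F}(\boldsymbol{M})$ is nonempty, let $\mu\in[0,1)$, and put $M_0=1$ and $l=\lceil (d+1)/2\rceil$. Then there is exactly one distribution $\underline F\in\mathcal{F}$ of the form $\underline F=\sum_{i=1}^{l} f_i\,\delta(x_i)$, with $0\le x_1<\dots<x_l\le1$ and $f_1,\dots,f_l\ge0$, satisfying - if $d$ is odd: $\sum_{i=1}^{l} f_i x_i^m=M_m$ for $m=0,1,\dots,d$; - if $d$ is even: $\sum_{i=1}^{l} f_i x_i^m=M_m$ for $m=0,1,\dots,d$, with $x_1=0$; and the supremum in $$\sup_{F\in\mathcal{F}(\boldsymbol{M})}\big(D_{\min}(F,\mu)-D_{\min}^{(d)}(\boldsymbol{M},\mu)\big)=\sup_{F\in\mathcal{F}(\boldsymbol{M})}D_{\min}(F,\mu)-D_{\min}^{(d)}(\boldsymbol{M},\mu)$$ is attained by $F=\underline F$.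
   Context: $\mathcal{F}$ is the family of all (Borel) probability distributions on $[0,1]$, and $\mathrm{E}_F[\cdot]$ denotes expectation when $X$ has distribution $F$. The Kullback-Leibler divergence is $D(F\Vert G)=\mathrm{E}_F[\log \frac{\mathrm{d}F}{\mathrm{d}G}]$ if the density $\frac{\mathrm{d}F}{\mathrm{d}G}$ exists, and $D(F\Vert G)=+\infty$ otherwise. For $F\in\mathcal{F}$ and $\mu\in[0,1]$, $$D_{\min}(F,\mu)=\min_{G\in\mathcal{F}:\,\mathrm{E}_G[X]\ge\mu} D(F\Vert G).$$ For $\boldsymbol{M}=(M_1,\dots,M_d)$ let $\mathcal{F}(\boldsymbol{M})=\{F\in\mathcal{F}:(\mathrm{E}_F[X],\dots,\mathrm{E}_F[X^d])=\boldsymbol{M}\}$ and $D_{\min}^{(d)}(\boldsymbol{M},\mu)=\inf_{F\in\mathcal{F}(\boldsymbol{M})}D_{\min}(F,\mu)$. $\delta(x)$ is the unit point mass at $x$. The convention $0^0=1$ is used. Weights $f_i$ are allowed to be zero, and uniqueness refers to the distribution $\underline F$. *)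

theory Defs
  imports "HOL-Probability.Probability"
begin

text \<open>
  A distribution on the unit interval is a Borel probability measure on the real line
  that is concentrated on \<open>{0..1}\<close>.
\<close>

definition unit_dists :: "real measure set" where
  "unit_dists = {F. prob_space F \<and> sets F = sets borel \<and> measure F {0..1} = 1}"

text \<open>
  The divergence of \<open>F\<close> with respect to \<open>G\<close>, in nats. The library constant
  \<^const>\<open>KL_divergence\<close> takes the reference measure \<open>G\<close> first; being a Bochner integral, it is
  0 instead of infinite for a log-density that is not integrable. The negative part of the
  log-density is always integrable (lemma \<open>KL_neg_part_finite\<close> below), so a log-density that is
  not integrable has expectation \<open>\<infinity>\<close>.
\<close>

definition KL :: "real measure \<Rightarrow> real measure \<Rightarrow> ereal" where
  "KL F G =
    (if absolutely_continuous G F \<and> integrable F (entropy_density (exp 1) G F)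
     then ereal (KL_divergence (exp 1) G F) else \<infinity>)"

lemma KL_neg_part_finite:
  assumes F: "F \<in> unit_dists" and G: "G \<in> unit_dists" and ac: "absolutely_continuous G F"
  shows "(\<integral>\<^sup>+ x. ennreal (- entropy_density (exp 1) G F x) \<partial>F) < \<infinity>"
proof -
  interpret G: prob_space G using G by (simp add: unit_dists_def)
  have s: "sets F = sets G" using F G by (simp add: unit_dists_def)
  have dens: "density G (RN_deriv G F) = F"
    using G.density_RN_deriv[OF ac s] .
  have bound: "r * ennreal (- log (exp 1) (enn2real r)) \<le> 1" for r :: ennreal
  proof (cases r)
    case (real h)
    show ?thesis
    proof (cases "0 < h \<and> h < 1")
      case True
      then have "ln (1 / h) \<le> 1 / h - 1" by (intro ln_le_minus_one) simp
      with True have "h * (- ln h) \<le> h * (1 / h - 1)"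
        by (intro mult_left_mono) (simp_all add: ln_div)
      also have "\<dots> \<le> 1" using True by (simp add: field_simps)
      finally have "h * (- ln h) \<le> 1" .
      moreover have "0 \<le> - ln h" using True by simp
      ultimately show ?thesis using real True
        by (simp add: log_def ennreal_mult[symmetric] ennreal_le_1 del: ln_le_zero_iff)
    next
      case False
      with real have "h = 0 \<or> 0 \<le> ln h" by auto
      with real show ?thesis by (auto simp: log_def ennreal_neg)
    qed
  qed (simp add: log_def)
  have "(\<integral>\<^sup>+ x. ennreal (- entropy_density (exp 1) G F x) \<partial>F)
      = (\<integral>\<^sup>+ x. ennreal (- entropy_density (exp 1) G F x) \<partial>density G (RN_deriv G F))"
    by (simp add: dens)
  also have "\<dots> = (\<integral>\<^sup>+ x. RN_deriv G F x * ennreal (- entropy_density (exp 1) G F x) \<partial>G)"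
    by (rule nn_integral_density) (simp_all add: entropy_density_def)
  also have "\<dots> \<le> (\<integral>\<^sup>+ x. 1 \<partial>G)"
    by (intro nn_integral_mono) (simp add: entropy_density_def bound)
  finally show ?thesis by (simp add: G.emeasure_space_1 le_less_trans)
qed

definition D_min :: "real measure \<Rightarrow> real \<Rightarrow> ereal" where
  "D_min F \<mu> = (INF G \<in> {G \<in> unit_dists. (\<integral>x. x \<partial>G) \<ge> \<mu>}. KL F G)"

definition moment_class :: "nat \<Rightarrow> (nat \<Rightarrow> real) \<Rightarrow> real measure set" where
  "moment_class d M = {F \<in> unit_dists. \<forall>m\<in>{1..d}. (\<integral>x. x ^ m \<partial>F) = M m}"

definition D_min_moments :: "nat \<Rightarrow> (nat \<Rightarrow> real) \<Rightarrow> real \<Rightarrow> ereal" where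
  "D_min_moments d M \<mu> = (INF F \<in> moment_class d M. D_min F \<mu>)"

text \<open>
  \<open>F\<close> is the sum of the point masses at \<open>x 1, \<dots>, x l\<close> with weights \<open>f 1, \<dots>, f l\<close>;
  \<^term>\<open>return borel a\<close> is the unit point mass at \<open>a\<close>.
\<close>

definition is_atomic_sum ::
  "nat \<Rightarrow> (nat \<Rightarrow> real) \<Rightarrow> (nat \<Rightarrow> real) \<Rightarrow> real measure \<Rightarrow> bool" where
  "is_atomic_sum l f x F \<longleftrightarrow>
    (\<forall>A \<in> sets borel. measure F A = (\<Sum>i=1..l. f i * measure (return borel (x i)) A))"

definition is_lower_dist :: "nat \<Rightarrow> nat \<Rightarrow> (nat \<Rightarrow> real) \<Rightarrow> real measure \<Rightarrow> bool" where
  "is_lower_dist d l M F \<longleftrightarrow> F \<in> unit_dists \<and>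
    (\<exists>f x. is_atomic_sum l f x F \<and>
      0 \<le> x 1 \<and> strict_mono_on {1..l} x \<and> x l \<le> 1 \<and> (\<forall>i\<in>{1..l}. 0 \<le> f i) \<and>
      (\<forall>m\<in>{0..d}. (\<Sum>i=1..l. f i * x i ^ m) = M m) \<and>
      (even d \<longrightarrow> x 1 = 0))"

end

theory Submission
  imports Defs "HOL-Computational_Algebra.Polynomial"
begin

text \<open>
  With \<open>v(x) = (x - \<mu>) / (1 - \<mu>)\<close>, convex duality gives
  \<open>D\<^sub>m\<^sub>i\<^sub>n(F, \<mu>) = sup\<^sub>t E\<^sub>F[ln (1 - t v(X))]\<close> over \<open>0 \<le> t < 1\<close>. Up to an additive constant the
  integrand is \<open>ln (1 - r x)\<close> with \<open>0 \<le> r < 1\<close>, a power series with nonpositive coefficients, so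
  \<open>D\<^sub>m\<^sub>i\<^sub>n\<close> is maximal where all moments are simultaneously minimal. The lower distribution has this
  property, because the remainder of \<open>x ^ k\<close> modulo \<open>x ^ e \<Prod> (x - x\<^sub>i)\<^sup>2\<close> lies below \<open>x ^ k\<close>. The
  distribution itself is a Gauss quadrature of \<open>x ^ e dF\<close>, where \<open>e = 0\<close> for odd and \<open>e = 1\<close> for
  even \<open>d\<close>.
\<close>

subsection \<open>Integration against distributions on the unit interval\<close>

lemma unit_distsD:
  assumes "F \<in> unit_dists"
  shows "prob_space F" "sets F = sets borel" "space F = UNIV" "AE x in F. x \<in> {0..1}"
proof -
  show F: "prob_space F" and s: "sets F = sets borel"
    using assms by (auto simp: unit_dists_def)
  show "space F = UNIV"
    using sets_eq_imp_space_eq[OF s] by simp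
  show "AE x in F. x \<in> {0..1}"
    using assms by (intro prob_space.AE_prob_1[OF F]) (auto simp: unit_dists_def)
qed

lemma measurable_unit_dists:
  assumes "F \<in> unit_dists"
  shows "f \<in> borel_measurable F \<longleftrightarrow> f \<in> borel_measurable borel"
  unfolding measurable_cong_sets[OF unit_distsD(2)[OF assms] refl] ..

lemma borel_measurable_poly [measurable]: "poly p \<in> borel_measurable borel" for p :: "real poly"
  by (intro borel_measurable_continuous_onI continuous_intros)

lemma unit_distsI:
  assumes "sets F = sets borel" "emeasure F UNIV = 1" "AE x in F. x \<in> {0..1}"
  shows "F \<in> unit_dists"
proof -
  have sp: "space F = UNIV"
    using sets_eq_imp_space_eq[OF assms(1)] by simp
  interpret prob_space F
    using assms(2) sp by (intro prob_spaceI) simp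
  have "measure F {0..1} = 1"
    using assms(1,3) by (subst prob_eq_1) auto
  with assms(1) prob_space_axioms show ?thesis
    by (simp add: unit_dists_def)
qed

lemma integrable_unit_dists:
  fixes f :: "real \<Rightarrow> real"
  assumes F: "F \<in> unit_dists" and f: "f \<in> borel_measurable borel"
    and B: "\<And>x. 0 \<le> x \<Longrightarrow> x \<le> 1 \<Longrightarrow> \<bar>f x\<bar> \<le> B"
  shows "integrable F f"
proof -
  interpret prob_space F using unit_distsD[OF F] by simp
  show ?thesis
  proof (rule integrable_const_bound)
    show "AE x in F. norm (f x) \<le> B"
      using unit_distsD(4)[OF F] by eventually_elim (simp add: B)
  qed (use f measurable_unit_dists[OF F] in blast)
qed

lemma continuous_bounded_unit:
  fixes f :: "real \<Rightarrow> real"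
  assumes "continuous_on {0..1} f"
  obtains B where "\<And>x. 0 \<le> x \<Longrightarrow> x \<le> 1 \<Longrightarrow> \<bar>f x\<bar> \<le> B"
proof -
  have "bounded (f ` {0..1})"
    using assms by (intro compact_imp_bounded compact_continuous_image) auto
  then show ?thesis
    using that unfolding bounded_iff by (metis atLeastAtMost_iff image_eqI real_norm_def)
qed

lemma integrable_poly_unit_dists:
  assumes F: "F \<in> unit_dists"
  shows "integrable F (poly p)"
proof -
  have "continuous_on {0..1} (poly p)"
    by (intro continuous_intros)
  then obtain B where "\<And>x. 0 \<le> x \<Longrightarrow> x \<le> 1 \<Longrightarrow> \<bar>poly p x\<bar> \<le> B"
    using continuous_bounded_unit by blast
  then show ?thesis
    by (intro integrable_unit_dists[OF F]) auto
qed

lemma integrable_power_unit_dists: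
  assumes "F \<in> unit_dists"
  shows "integrable F (\<lambda>x. x ^ k)"
  using integrable_poly_unit_dists[OF assms, of "monom 1 k"] by (simp add: poly_monom[abs_def])

lemma integral_mono_unit_dists:
  fixes f g :: "real \<Rightarrow> real"
  assumes F: "F \<in> unit_dists" and "integrable F f" "integrable F g"
    and le: "\<And>x. 0 \<le> x \<Longrightarrow> x \<le> 1 \<Longrightarrow> f x \<le> g x"
  shows "(\<integral>x. f x \<partial>F) \<le> (\<integral>x. g x \<partial>F)"
proof (rule integral_mono_AE)
  show "AE x in F. f x \<le> g x"
    using unit_distsD(4)[OF F] by eventually_elim (simp add: le)
qed fact+

lemma integral_poly_cong_moments:
  assumes F: "F \<in> unit_dists" and G: "G \<in> unit_dists"
    and m: "\<And>m. m \<le> d \<Longrightarrow> (\<integral>x. x ^ m \<partial>F) = (\<integral>x. x ^ m \<partial>G)"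
    and p: "degree p \<le> d"
  shows "(\<integral>x. poly p x \<partial>F) = (\<integral>x. poly p x \<partial>G)"
proof -
  have "(\<integral>x. poly p x \<partial>H) = (\<Sum>i\<le>degree p. coeff p i * (\<integral>x. x ^ i \<partial>H))"
    if "H \<in> unit_dists" for H
    unfolding poly_altdef using integrable_power_unit_dists[OF that] by (subst Bochner_Integration.integral_sum) auto
  from this[OF F] this[OF G] show ?thesis
    using m p by simp
qed

subsection \<open>Atomic distributions\<close>

lemma atomic_sum_eq_distr:
  assumes F: "F \<in> unit_dists" and at: "is_atomic_sum l f x F"
    and f: "\<And>i. i \<in> {1..l} \<Longrightarrow> 0 \<le> f i"
  shows "F = distr (point_measure {1..l} (\<lambda>i. ennreal (f i))) borel x"
proof (rule measure_eqI)
  interpret prob_space F using unit_distsD[OF F] by simp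
  have [measurable]: "x \<in> borel_measurable (point_measure {1..l} (\<lambda>i. ennreal (f i)))"
    by simp
  show "sets F = sets (distr (point_measure {1..l} (\<lambda>i. ennreal (f i))) borel x)"
    using unit_distsD[OF F] by simp
  fix A assume "A \<in> sets F"
  then have A: "A \<in> sets borel"
    using unit_distsD[OF F] by simp
  have "emeasure F A = ennreal (\<Sum>i=1..l. f i * measure (return borel (x i)) A)"
    using at A by (simp add: emeasure_eq_measure is_atomic_sum_def)
  also have "\<dots> = ennreal (\<Sum>i\<in>x -` A \<inter> {1..l}. f i)"
    using A by (simp add: measure_return indicator_def sum.If_cases Int_commute vimage_def)
  also have "\<dots> = (\<Sum>i\<in>x -` A \<inter> {1..l}. ennreal (f i))"
    using f by (subst sum_ennreal) auto
  also have "\<dots> = emeasure (distr (point_measure {1..l} (\<lambda>i. ennreal (f i))) borel x) A"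
    using A by (simp add: emeasure_distr emeasure_point_measure_finite space_point_measure)
  finally show "emeasure F A = emeasure (distr (point_measure {1..l} (\<lambda>i. ennreal (f i))) borel x) A" .
qed

lemma integral_atomic_sum:
  fixes g :: "real \<Rightarrow> real"
  assumes "F \<in> unit_dists" "is_atomic_sum l f x F" "\<And>i. i \<in> {1..l} \<Longrightarrow> 0 \<le> f i"
    and "g \<in> borel_measurable borel"
  shows "(\<integral>y. g y \<partial>F) = (\<Sum>i=1..l. f i * g (x i))"
proof -
  note eq = atomic_sum_eq_distr[OF assms(1,2) assms(3)]
  have "(\<integral>y. g y \<partial>F) = (\<integral>y. g y \<partial>distr (point_measure {1..l} (\<lambda>i. ennreal (f i))) borel x)"
    using eq by simp
  also have "\<dots> = (\<Sum>i=1..l. f i * g (x i))"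
    using assms(3,4)
    by (subst integral_distr, simp_all, subst lebesgue_integral_point_measure_finite) auto
  finally show ?thesis .
qed

lemma ex_atomic_sum:
  assumes f: "\<And>i. i \<in> {1..l} \<Longrightarrow> 0 \<le> f i" "(\<Sum>i=1..l. f i) = 1"
    and x: "\<And>i. i \<in> {1..l} \<Longrightarrow> x i \<in> {0..1}"
  shows "\<exists>F\<in>unit_dists. is_atomic_sum l f x F"
proof -
  define F where "F = distr (point_measure {1..l} (\<lambda>i. ennreal (f i))) borel x"
  have em: "emeasure F A = ennreal (\<Sum>i=1..l. f i * measure (return borel (x i)) A)"
    if A: "A \<in> sets borel" for A
  proof -
    have "emeasure F A = (\<Sum>i\<in>x -` A \<inter> {1..l}. ennreal (f i))"
      using A by (simp add: F_def emeasure_distr emeasure_point_measure_finite space_point_measure)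
    also have "\<dots> = ennreal (\<Sum>i\<in>x -` A \<inter> {1..l}. f i)"
      using f by (subst sum_ennreal) auto
    also have "\<dots> = ennreal (\<Sum>i=1..l. f i * measure (return borel (x i)) A)"
      using A by (simp add: measure_return indicator_def sum.If_cases Int_commute vimage_def)
    finally show ?thesis .
  qed
  have nn: "0 \<le> (\<Sum>i=1..l. f i * measure (return borel (x i)) A)" for A
    using f by (intro sum_nonneg mult_nonneg_nonneg) auto
  have "is_atomic_sum l f x F"
    unfolding is_atomic_sum_def
  proof
    fix A :: "real set" assume "A \<in> sets borel"
    from em[OF this] nn[of A] show
      "measure F A = (\<Sum>i=1..l. f i * measure (return borel (x i)) A)"
      by (simp only: Sigma_Algebra.measure_def[of F] enn2real_ennreal)
  qed
  moreover have "F \<in> unit_dists"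
  proof (rule unit_distsI)
    show "emeasure F UNIV = 1"
      using em[of UNIV] f(2) by (simp add: measure_return)
    show "AE y in F. y \<in> {0..1}"
      using x unfolding F_def by (subst AE_distr_iff) (auto simp: AE_point_measure)
  qed (simp add: F_def)
  ultimately show ?thesis by auto
qed

lemma poly_interpolation:
  fixes g :: "'a::field \<Rightarrow> 'a"
  assumes "finite S"
  shows "\<exists>p. degree p \<le> card S - 1 \<and> (\<forall>y\<in>S. poly p y = g y)"
  using assms
proof induction
  case empty
  show ?case by (auto intro: exI[of _ 0])
next
  case (insert a S)
  then obtain p where p: "degree p \<le> card S - 1" "\<And>y. y \<in> S \<Longrightarrow> poly p y = g y"
    by auto
  define N where "N = (\<Prod>s\<in>S. [:- s, 1:])"
  define c where "c = (g a - poly p a) / poly N a"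
  have "poly N a \<noteq> 0"
    using insert by (auto simp: N_def poly_prod)
  have N0: "poly N y = 0" if "y \<in> S" for y
    using insert that by (auto simp: N_def poly_prod)
  have "degree N \<le> (\<Sum>s\<in>S. 1)"
    unfolding N_def by (rule order.trans[OF degree_prod_sum_le]) (use insert in auto)
  then have "degree (p + smult c N) \<le> card (insert a S) - 1"
    using insert p(1) by (intro degree_add_le) auto
  moreover have "\<forall>y\<in>insert a S. poly (p + smult c N) y = g y"
    using p(2) N0 \<open>poly N a \<noteq> 0\<close> by (auto simp: c_def)
  ultimately show ?case by blast
qed

text \<open>On finitely many atoms every indicator function is a polynomial.\<close>

lemma atomic_sum_eqI:
  assumes F: "F \<in> unit_dists" "is_atomic_sum l f x F" "\<And>i. i \<in> {1..l} \<Longrightarrow> 0 \<le> f i"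
    and G: "G \<in> unit_dists" "is_atomic_sum k g y G" "\<And>i. i \<in> {1..k} \<Longrightarrow> 0 \<le> g i"
    and m: "\<And>m. (\<integral>x. x ^ m \<partial>F) = (\<integral>x. x ^ m \<partial>G)"
  shows "F = G"
proof (rule measure_eqI)
  interpret F: prob_space F using unit_distsD[OF F(1)] by simp
  interpret G: prob_space G using unit_distsD[OF G(1)] by simp
  show "sets F = sets G"
    using unit_distsD[OF F(1)] unit_distsD[OF G(1)] by simp
  fix A assume "A \<in> sets F"
  then have A[measurable]: "A \<in> sets borel"
    using unit_distsD[OF F(1)] by simp
  obtain p where p: "\<And>z. z \<in> x ` {1..l} \<union> y ` {1..k} \<Longrightarrow> poly p z = indicator A z"
    using poly_interpolation[of "x ` {1..l} \<union> y ` {1..k}" "indicator A"] by auto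
  have "measure F A = (\<integral>z. indicator A z \<partial>F)"
    using A unit_distsD[OF F(1)] by simp
  also have "\<dots> = (\<integral>z. poly p z \<partial>F)"
    using integral_atomic_sum[OF F, of "indicator A"] integral_atomic_sum[OF F, of "poly p"] p A
    by (simp del: Bochner_Integration.integral_indicator)
  also have "\<dots> = (\<integral>z. poly p z \<partial>G)"
    by (rule integral_poly_cong_moments[OF F(1) G(1) m order.refl])
  also have "\<dots> = (\<integral>z. indicator A z \<partial>G)"
    using integral_atomic_sum[OF G, of "indicator A"] integral_atomic_sum[OF G, of "poly p"] p A
    by (simp del: Bochner_Integration.integral_indicator)
  also have "\<dots> = measure G A"
    using A unit_distsD[OF G(1)] by simp
  finally show "emeasure F A = emeasure G A"
    by (simp add: F.emeasure_eq_measure G.emeasure_eq_measure)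
qed

subsection \<open>Extremality of the lower distribution\<close>

lemma synthetic_div_coeff_nonneg:
  fixes c :: "'a::linordered_idom"
  assumes "0 \<le> c" "\<And>i. 0 \<le> coeff p i"
  shows "0 \<le> coeff (synthetic_div p c) i"
  using assms(2)
proof (induction p arbitrary: i)
  case (pCons a p)
  have p: "0 \<le> coeff p j" for j
    using pCons.prems[of "Suc j"] by simp
  have "0 \<le> poly p c"
    using p assms(1) by (auto simp: poly_altdef intro!: sum_nonneg)
  with pCons.IH[OF p] show ?case
    by (auto simp: coeff_pCons split: nat.split)
qed simp

lemma poly_division_nonneg:
  fixes cs :: "'a::linordered_idom list"
  assumes "\<And>c. c \<in> set cs \<Longrightarrow> 0 \<le> c" "\<And>i. 0 \<le> coeff p i"
  shows "\<exists>R P. p = (\<Prod>c\<leftarrow>cs. [:- c, 1:]) * R + P \<and> (\<forall>i. 0 \<le> coeff R i) \<and> degree P \<le> length cs - 1"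
  using assms
proof (induction cs arbitrary: p)
  case Nil
  then show ?case by (intro exI[of _ p] exI[of _ 0]) auto
next
  case (Cons c cs)
  let ?q = "synthetic_div p c" and ?Q = "\<Prod>c\<leftarrow>cs. [:- c, 1:]"
  obtain R P where RP: "?q = ?Q * R + P" "\<And>i. 0 \<le> coeff R i" "degree P \<le> length cs - 1"
    using Cons.IH[of ?q] Cons.prems synthetic_div_coeff_nonneg[of c p] by auto
  have "p = [:-c, 1:] * (?Q * R + P) + [:poly p c:]"
    using synthetic_div_correct'[of c p] RP(1) by simp
  then have 1: "p = [:-c, 1:] * ?Q * R + ([:-c, 1:] * P + [:poly p c:])"
    by (simp only: algebra_simps)
  show ?case
  proof (cases cs)
    case Nil
    then show ?thesis
      using synthetic_div_correct'[of c p] synthetic_div_coeff_nonneg[of c p] Cons.prems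
      by (intro exI[of _ ?q] exI[of _ "[:poly p c:]"]) auto
  next
    case (Cons a list)
    have "degree ([:-c, 1:] * P) \<le> 1 + degree P"
      by (rule order.trans[OF degree_mult_le]) auto
    also have "\<dots> \<le> length cs"
      using RP(3) Cons by simp
    finally have "degree ([:-c, 1:] * P + [:poly p c:]) \<le> length (c # cs) - 1"
      by (intro degree_add_le) auto
    with 1 RP(2) show ?thesis
      by (intro exI[of _ R] exI[of _ "[:-c, 1:] * P + [:poly p c:]"]) auto
  qed
qed

text \<open>
  Since \<open>x ^ k = Q(x) R(x) + P(x)\<close> with \<open>Q, R \<ge> 0\<close> on the unit interval, \<open>Q = 0\<close> on the atoms
  of \<open>G\<close> and \<open>P\<close> of degree at most \<open>d\<close>, the moments of \<open>G\<close> are minimal.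
\<close>

lemma atomic_moment_minimal:
  assumes F: "F \<in> unit_dists" and G: "G \<in> unit_dists"
    and at: "is_atomic_sum l f x G" "\<And>i. i \<in> {1..l} \<Longrightarrow> 0 \<le> f i"
    and m: "\<And>m. m \<le> d \<Longrightarrow> (\<integral>x. x ^ m \<partial>F) = (\<integral>x. x ^ m \<partial>G)"
    and cs: "length cs = Suc d" "\<And>c. c \<in> set cs \<Longrightarrow> 0 \<le> c"
      "\<And>y::real. 0 \<le> y \<Longrightarrow> 0 \<le> (\<Prod>c\<leftarrow>cs. y - c)" "x ` {1..l} \<subseteq> set cs"
  shows "(\<integral>x. x ^ k \<partial>G) \<le> (\<integral>x. x ^ k \<partial>F)"
proof -
  define Q where "Q = (\<Prod>c\<leftarrow>cs. [:- c, 1:])"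
  have Q: "poly Q y = (\<Prod>c\<leftarrow>cs. y - c)" for y
    unfolding Q_def by (induction cs) (auto simp: algebra_simps)
  have "\<exists>R P. monom 1 k = Q * R + P \<and> (\<forall>i. 0 \<le> coeff R i) \<and> degree P \<le> length cs - 1"
    unfolding Q_def by (rule poly_division_nonneg) (auto simp: cs(2))
  then obtain R P where RP: "monom 1 k = Q * R + P" "\<And>i. 0 \<le> coeff R i" "degree P \<le> d"
    using cs(1) by auto
  have eq: "y ^ k = poly Q y * poly R y + poly P y" for y
    using arg_cong[OF RP(1), of "\<lambda>p. poly p y"] by (simp add: poly_monom)
  have "0 \<le> poly R y" if "0 \<le> y" for y
    using RP(2) that by (auto simp: poly_altdef intro!: sum_nonneg)
  then have ge: "poly P y \<le> y ^ k" if "0 \<le> y" for y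
    using eq[of y] cs(3)[OF that] that by (simp add: Q)
  have "poly Q (x i) = 0" if "i \<in> {1..l}" for i
    using cs(4) that by (force simp: Q prod_list_zero_iff)
  then have "x i ^ k = poly P (x i)" if "i \<in> {1..l}" for i
    using eq[of "x i"] that by simp
  then have "(\<integral>x. x ^ k \<partial>G) = (\<integral>x. poly P x \<partial>G)"
    using integral_atomic_sum[OF G at, of "\<lambda>x. x ^ k"] integral_atomic_sum[OF G at, of "poly P"]
    by simp
  also have "\<dots> = (\<integral>x. poly P x \<partial>F)"
    using integral_poly_cong_moments[OF F G m RP(3)] by simp
  also have "\<dots> \<le> (\<integral>x. x ^ k \<partial>F)"
    using integrable_poly_unit_dists[OF F, of P] integrable_power_unit_dists[OF F] ge
    by (intro integral_mono_unit_dists[OF F])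
  finally show ?thesis .
qed

lemma lower_dist_moments:
  assumes "is_lower_dist d l M G" "m \<le> d"
  shows "(\<integral>x. x ^ m \<partial>G) = M m"
proof -
  from assms(1) obtain f x where G: "G \<in> unit_dists" "is_atomic_sum l f x G"
    "\<And>i. i \<in> {1..l} \<Longrightarrow> 0 \<le> f i" and m: "\<And>m. m \<in> {0..d} \<Longrightarrow> (\<Sum>i=1..l. f i * x i ^ m) = M m"
    unfolding is_lower_dist_def by blast
  show ?thesis
    using m[of m] assms(2) integral_atomic_sum[OF G, of "\<lambda>x. x ^ m"] by simp
qed

lemma lower_dist_moment_minimal:
  assumes low: "is_lower_dist d l M G" and l: "l = d div 2 + 1"
    and F: "F \<in> unit_dists" and m: "\<And>m. m \<le> d \<Longrightarrow> (\<integral>x. x ^ m \<partial>F) = M m"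
  shows "(\<integral>x. x ^ k \<partial>G) \<le> (\<integral>x. x ^ k \<partial>F)"
proof -
  from low obtain f x where G: "G \<in> unit_dists" "is_atomic_sum l f x G"
    "\<And>i. i \<in> {1..l} \<Longrightarrow> 0 \<le> f i"
    and x: "0 \<le> x 1" "strict_mono_on {1..l} x" "x l \<le> 1" and ev: "even d \<Longrightarrow> x 1 = 0"
    unfolding is_lower_dist_def by blast
  have x0: "0 \<le> x i" if "i \<in> {1..l}" for i
    using x(1) strict_mono_on_leD[OF x(2), of 1 i] that by auto
  have mm: "(\<integral>x. x ^ m \<partial>F) = (\<integral>x. x ^ m \<partial>G)" if "m \<le> d" for m
    using that m lower_dist_moments[OF low] by simp
  have sq: "0 \<le> (\<Prod>c\<leftarrow>ys. y - c) * (\<Prod>c\<leftarrow>ys. y - c)" for ys and y :: real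
    by simp
  show ?thesis
  proof (cases "even d")
    case True
    define ys where "ys = map x [2..<Suc l]"
    have "{1..l} = insert 1 {2..<Suc l}"
      using l by auto
    then show ?thesis
      using True ev l sq x0
      by (intro atomic_moment_minimal[OF F G mm, where cs = "0 # ys @ ys"])
         (auto simp: ys_def simp del: upt_Suc)
  next
    case False
    define ys where "ys = map x [1..<Suc l]"
    show ?thesis
      using False l sq x0
      by (intro atomic_moment_minimal[OF F G mm, where cs = "ys @ ys"])
         (auto simp: ys_def elim!: oddE simp del: upt_Suc)
  qed
qed

lemma lower_dist_unique:
  assumes "is_lower_dist d l M F" "is_lower_dist d l M G" and l: "l = d div 2 + 1"
  shows "F = G"
proof -
  obtain f x where F: "F \<in> unit_dists" "is_atomic_sum l f x F" "\<And>i. i \<in> {1..l} \<Longrightarrow> 0 \<le> f i"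
    using assms(1) unfolding is_lower_dist_def by blast
  obtain g y where G: "G \<in> unit_dists" "is_atomic_sum l g y G" "\<And>i. i \<in> {1..l} \<Longrightarrow> 0 \<le> g i"
    using assms(2) unfolding is_lower_dist_def by blast
  show ?thesis
    using lower_dist_moment_minimal[OF assms(1) l G(1) lower_dist_moments[OF assms(2)]]
      lower_dist_moment_minimal[OF assms(2) l F(1) lower_dist_moments[OF assms(1)]]
    by (intro atomic_sum_eqI[OF F G] antisym)
qed

subsection \<open>Duality for the minimal divergence\<close>

lemma KL_weak_duality:
  assumes F: "F \<in> unit_dists" and G: "G \<in> unit_dists"
    and w: "w \<in> borel_measurable borel" "integrable F (\<lambda>x. ln (w x))" "integrable G w" "(\<integral>x. w x \<partial>G) \<le> 1"
    and pos: "\<And>x. 0 \<le> x \<Longrightarrow> x \<le> 1 \<Longrightarrow> 0 < w x"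
  shows "ereal (\<integral>x. ln (w x) \<partial>F) \<le> KL F G"
proof (cases "absolutely_continuous G F \<and> integrable F (entropy_density (exp 1) G F)")
  case True
  interpret F: prob_space F using unit_distsD[OF F] by simp
  interpret G: prob_space G using unit_distsD[OF G] by simp
  have s: "sets F = sets G" using unit_distsD[OF F] unit_distsD[OF G] by simp
  have [measurable]: "w \<in> borel_measurable F" "w \<in> borel_measurable G"
    using w(1) measurable_unit_dists[OF F] measurable_unit_dists[OF G] by auto
  obtain D where D[measurable]: "D \<in> borel_measurable G"
    and eq: "AE x in G. RN_deriv G F x = ennreal (D x)"
    and DF: "AE x in F. 0 < D x" and D0: "\<And>x. 0 \<le> D x"
    using G.real_RN_deriv[OF F.finite_measure_axioms conjunct1[OF True] s] by blast
  have [measurable]: "D \<in> borel_measurable F"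
    using D measurable_unit_dists[OF F] measurable_unit_dists[OF G] by blast
  have Fd: "F = density G (\<lambda>x. ennreal (D x))"
    using G.density_RN_deriv[OF conjunct1[OF True] s] density_cong[OF _ _ eq] by simp
  have "AE x in F. entropy_density (exp 1) G F x = ln (D x)"
    using absolutely_continuous_AE[OF s conjunct1[OF True] eq]
    by eventually_elim (simp add: entropy_density_def D0 log_def)
  then have ent: "integrable F (\<lambda>x. ln (D x))" "KL_divergence (exp 1) G F = (\<integral>x. ln (D x) \<partial>F)"
    using True unfolding KL_divergence_def
    by (auto intro!: integral_cong_AE elim: integrable_cong_AE_imp)
  have "(\<integral>\<^sup>+x. ennreal (w x / D x) \<partial>F) = (\<integral>\<^sup>+x. ennreal (D x) * ennreal (w x / D x) \<partial>G)"
    by (subst Fd, subst nn_integral_density) auto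
  also have "\<dots> \<le> (\<integral>\<^sup>+x. ennreal (w x) \<partial>G)"
  proof (rule nn_integral_mono_AE)
    show "AE x in G. ennreal (D x) * ennreal (w x / D x) \<le> ennreal (w x)"
      using unit_distsD(4)[OF G]
    proof eventually_elim
      case (elim x)
      then show ?case
        using pos[of x] D0[of x] by (cases "D x = 0") (auto simp: ennreal_mult'[symmetric])
    qed
  qed
  also have "\<dots> = ennreal (\<integral>x. w x \<partial>G)"
  proof (rule nn_integral_eq_integral[OF w(3)])
    show "AE x in G. 0 \<le> w x"
      using unit_distsD(4)[OF G] by eventually_elim (use pos in \<open>auto intro: less_imp_le\<close>)
  qed
  also have "\<dots> \<le> ennreal 1"
    using w(4) by (rule ennreal_leI)
  finally have le: "(\<integral>\<^sup>+x. ennreal (w x / D x) \<partial>F) \<le> ennreal 1" .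
  have nn: "AE x in F. 0 \<le> w x / D x"
    using unit_distsD(4)[OF F] DF
    by eventually_elim (use pos in \<open>auto intro!: divide_nonneg_pos less_imp_le\<close>)
  have int: "integrable F (\<lambda>x. w x / D x)"
    using le nn by (intro integrableI_nonneg) (auto intro: le_less_trans)
  then have le1: "(\<integral>x. w x / D x \<partial>F) \<le> 1"
    using le nn by (subst (asm) nn_integral_eq_integral) auto
  have "(\<integral>x. ln (w x) \<partial>F) - (\<integral>x. ln (D x) \<partial>F) = (\<integral>x. ln (w x) - ln (D x) \<partial>F)"
    using w(2) ent(1) by simp
  also have "\<dots> \<le> (\<integral>x. w x / D x - 1 \<partial>F)"
  proof (rule integral_mono_AE)
    show "AE x in F. ln (w x) - ln (D x) \<le> w x / D x - 1"
      using unit_distsD(4)[OF F] DF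
    proof eventually_elim
      case (elim x)
      then show ?case
        using pos[of x] ln_le_minus_one[of "w x / D x"] by (simp add: ln_div)
    qed
  qed (use w(2) ent(1) int in auto)
  also have "\<dots> \<le> 0"
    using int le1 by (simp add: F.prob_space)
  finally show ?thesis
    using True ent(2) by (simp add: KL_def)
next
  case False
  then show ?thesis by (simp only: KL_def if_False) simp
qed

lemma linear_bounds:
  fixes \<mu> t x :: real
  assumes "0 \<le> \<mu>" "\<mu> < 1" "0 \<le> t" "t < 1" "0 \<le> x" "x \<le> 1"
  shows "1 - t \<le> 1 - t * ((x - \<mu>) / (1 - \<mu>))" "\<bar>(x - \<mu>) / (1 - \<mu>)\<bar> \<le> 1 / (1 - \<mu>)"
proof -
  have v: "(x - \<mu>) / (1 - \<mu>) \<le> 1" "- (\<mu> / (1 - \<mu>)) \<le> (x - \<mu>) / (1 - \<mu>)"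
    using assms by (auto simp: field_simps)
  have 1: "1 / (1 - \<mu>) = 1 + \<mu> / (1 - \<mu>)" "0 \<le> \<mu> / (1 - \<mu>)"
    using assms by (auto simp: field_simps)
  show "1 - t \<le> 1 - t * ((x - \<mu>) / (1 - \<mu>))"
    using mult_left_mono[OF v(1) assms(3)] by simp
  show "\<bar>(x - \<mu>) / (1 - \<mu>)\<bar> \<le> 1 / (1 - \<mu>)"
    using v 1 unfolding abs_le_iff by linarith
qed

lemma ln_linear_integrable:
  assumes F: "F \<in> unit_dists" and "0 \<le> \<mu>" "\<mu> < 1" "0 \<le> t" "t < 1"
  shows "integrable F (\<lambda>x. ln (1 - t * ((x - \<mu>) / (1 - \<mu>))))"
proof -
  have "continuous_on {0..1} (\<lambda>x. ln (1 - t * ((x - \<mu>) / (1 - \<mu>))))"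
    using linear_bounds(1)[OF assms(2-5)] assms
    by (intro continuous_intros) (smt (verit) atLeastAtMost_iff)+
  then obtain B where "\<And>x. 0 \<le> x \<Longrightarrow> x \<le> 1 \<Longrightarrow> \<bar>ln (1 - t * ((x - \<mu>) / (1 - \<mu>)))\<bar> \<le> B"
    by (rule continuous_bounded_unit) blast
  then show ?thesis
    by (intro integrable_unit_dists[OF F]) auto
qed

lemma D_min_ge_dual:
  assumes F: "F \<in> unit_dists" and \<mu>: "0 \<le> \<mu>" "\<mu> < 1" and t: "0 \<le> t" "t < 1"
  shows "ereal (\<integral>x. ln (1 - t * ((x - \<mu>) / (1 - \<mu>))) \<partial>F) \<le> D_min F \<mu>"
  unfolding D_min_def
proof (rule INF_greatest)
  fix G assume "G \<in> {G \<in> unit_dists. \<mu> \<le> (\<integral>x. x \<partial>G)}"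
  then have G: "G \<in> unit_dists" and mean: "\<mu> \<le> (\<integral>x. x \<partial>G)" by auto
  interpret G: prob_space G using unit_distsD[OF G] by simp
  have id: "integrable G (\<lambda>x. x)"
    by (rule integrable_unit_dists[OF G]) auto
  show "ereal (\<integral>x. ln (1 - t * ((x - \<mu>) / (1 - \<mu>))) \<partial>F) \<le> KL F G"
  proof (rule KL_weak_duality[OF F G])
    show "integrable F (\<lambda>x. ln (1 - t * ((x - \<mu>) / (1 - \<mu>))))"
      by (rule ln_linear_integrable[OF F \<mu> t])
    show "integrable G (\<lambda>x. 1 - t * ((x - \<mu>) / (1 - \<mu>)))"
      using id by auto
    have "(\<integral>x. 1 - t * ((x - \<mu>) / (1 - \<mu>)) \<partial>G) = 1 - t * (((\<integral>x. x \<partial>G) - \<mu>) / (1 - \<mu>))"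
      using id by (simp add: G.prob_space)
    also have "\<dots> \<le> 1"
      using mean t \<mu> by simp
    finally show "(\<integral>x. 1 - t * ((x - \<mu>) / (1 - \<mu>)) \<partial>G) \<le> 1" .
    show "0 < 1 - t * ((x - \<mu>) / (1 - \<mu>))" if "0 \<le> x" "x \<le> 1" for x
      using linear_bounds(1)[OF \<mu> t that] t by linarith
  qed simp
qed

lemma ex_add_point_mass:
  assumes F: "prob_space F" "sets F = sets borel" and f: "f \<in> borel_measurable borel"
    and one: "(\<integral>\<^sup>+x. f x \<partial>F) + r = 1"
  shows "\<exists>G. sets G = sets borel \<and>
    (\<forall>g\<in>borel_measurable borel. (\<integral>\<^sup>+x. g x \<partial>G) = (\<integral>\<^sup>+x. f x * g x \<partial>F) + r * g (a::real))"
proof -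
  have [measurable_cong]: "sets F = sets borel" by fact
  have sp: "space F = UNIV" using sets_eq_imp_space_eq[OF F(2)] by simp
  note f[measurable]
  define K where "K b = (if b then density F f else density (return borel a) (\<lambda>_. r))" for b
  have "(\<integral>\<^sup>+x. f x \<partial>F) \<le> 1" "r \<le> 1"
    using one add_increasing2[of r "(\<integral>\<^sup>+x. f x \<partial>F)" "(\<integral>\<^sup>+x. f x \<partial>F)"]
      add_increasing[of "(\<integral>\<^sup>+x. f x \<partial>F)" r r] by auto
  then have "subprob_space (K b)" for b
    by (intro subprob_spaceI) (auto simp: K_def emeasure_density nn_integral_return sp cong: nn_integral_cong)
  moreover have sK: "sets (K b) = sets borel" for b
    by (simp add: K_def F(2))
  ultimately have K: "K \<in> measurable (count_space UNIV) (subprob_algebra borel)"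
    by (simp add: space_subprob_algebra)
  define G where "G = count_space UNIV \<bind> K"
  have "sets G = sets borel"
    unfolding G_def by (rule sets_bind) (auto simp: sK)
  moreover have "(\<integral>\<^sup>+x. g x \<partial>G) = (\<integral>\<^sup>+x. f x * g x \<partial>F) + r * g a" if [measurable]: "g \<in> borel_measurable borel" for g
    unfolding G_def
    by (subst nn_integral_bind[OF that K])
       (auto simp: nn_integral_count_space_finite UNIV_bool K_def nn_integral_density nn_integral_return add.commute)
  ultimately show ?thesis by blast
qed

text \<open>
  The competitor is \<open>F / w\<close>, with its missing mass moved to the point 1, where \<open>F\<close> then
  has no atom, so that the density of \<open>F\<close> is still \<open>w\<close>.
\<close>

lemma D_min_le_reweighted:
  assumes F: "F \<in> unit_dists" and \<mu>: "0 \<le> \<mu>" "\<mu> < 1"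
    and w[measurable]: "w \<in> borel_measurable borel" and pos: "AE x in F. 0 < w x"
    and mass: "(\<integral>\<^sup>+x. ennreal (1 / w x) \<partial>F) \<le> 1"
      "(\<integral>\<^sup>+x. ennreal (1 / w x) \<partial>F) = 1 \<or> (AE x in F. x \<noteq> 1)"
    and mean: "(\<integral>\<^sup>+x. ennreal ((1 - x) / w x) \<partial>F) \<le> ennreal (1 - \<mu>)"
    and int: "integrable F (\<lambda>x. ln (w x))"
  shows "D_min F \<mu> \<le> ereal (\<integral>x. ln (w x) \<partial>F)"
proof -
  note sF = unit_distsD(2)[OF F]
  note [measurable_cong] = sF
  interpret F: prob_space F using unit_distsD[OF F] by simp
  define r where "r = 1 - (\<integral>\<^sup>+x. ennreal (1 / w x) \<partial>F)"
  have one: "(\<integral>\<^sup>+x. ennreal (1 / w x) \<partial>F) + r = 1"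
    using mass(1) by (simp add: r_def diff_add_cancel_ennreal add.commute)
  have r: "r = 0 \<or> (AE x in F. x \<noteq> 1)"
    using mass(2) by (auto simp: r_def)
  obtain G where sG: "sets G = sets borel" and G: "\<And>g. g \<in> borel_measurable borel \<Longrightarrow>
    (\<integral>\<^sup>+x. g x \<partial>G) = (\<integral>\<^sup>+x. ennreal (1 / w x) * g x \<partial>F) + r * g (1::real)"
    using ex_add_point_mass[OF F.prob_space_axioms sF _ one, of 1] by auto
  note [measurable_cong] = sG
  have emG: "emeasure G A = (\<integral>\<^sup>+x. ennreal (1 / w x) * indicator A x \<partial>F) + r * indicator A 1"
    if "A \<in> sets borel" for A
    using that G[of "indicator A"] by (simp add: sG)
  have Gd: "G \<in> unit_dists"
  proof (rule unit_distsI[OF sG])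
    show "emeasure G UNIV = 1"
      using one by (simp add: emG)
    have "emeasure G (- {0..1}) = (\<integral>\<^sup>+x. 0 \<partial>F)"
    proof -
      have "(\<integral>\<^sup>+x. ennreal (1 / w x) * indicator (- {0..1}) x \<partial>F) = (\<integral>\<^sup>+x. 0 \<partial>F)"
        by (rule nn_integral_cong_AE) (use unit_distsD(4)[OF F] in eventually_elim, auto)
      then show ?thesis by (simp add: emG)
    qed
    then show "AE x in G. x \<in> {0..1}"
      by (intro AE_I[where N = "- {0..1}"]) (auto simp: sG)
  qed
  interpret G: prob_space G using unit_distsD[OF Gd] by simp
  have id: "integrable G (\<lambda>x. x)" "integrable G (\<lambda>x. 1 - x)"
    by (rule integrable_unit_dists[OF Gd, where B = 1]; auto)+
  have "ennreal (\<integral>x. 1 - x \<partial>G) = (\<integral>\<^sup>+x. ennreal (1 - x) \<partial>G)"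
  proof (rule nn_integral_eq_integral[symmetric, OF id(2)])
    show "AE x in G. 0 \<le> 1 - x"
      using unit_distsD(4)[OF Gd] by eventually_elim auto
  qed
  also have "\<dots> = (\<integral>\<^sup>+x. ennreal ((1 - x) / w x) \<partial>F)"
  proof -
    have "(\<integral>\<^sup>+x. ennreal (1 / w x) * ennreal (1 - x) \<partial>F) = (\<integral>\<^sup>+x. ennreal ((1 - x) / w x) \<partial>F)"
    proof (rule nn_integral_cong_AE)
      show "AE x in F. ennreal (1 / w x) * ennreal (1 - x) = ennreal ((1 - x) / w x)"
        using pos by eventually_elim (simp add: ennreal_mult'[symmetric])
    qed
    then show ?thesis by (simp add: G)
  qed
  also note mean
  finally have "(\<integral>x. 1 - x \<partial>G) \<le> 1 - \<mu>"
    using \<mu> by (simp add: ennreal_le_iff)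
  then have meanG: "\<mu> \<le> (\<integral>x. x \<partial>G)"
    using id by (simp add: G.prob_space)

  define k where "k x = (if r \<noteq> 0 \<and> x = 1 then 0 else max 0 (w x))" for x
  have [measurable]: "k \<in> borel_measurable borel"
    unfolding k_def by measurable
  have k: "AE x in F. k x = w x \<and> 0 < w x"
    using r
  proof
    assume "AE x in F. x \<noteq> 1"
    with pos show ?thesis by eventually_elim (simp add: k_def)
  next
    assume "r = 0"
    with pos show ?thesis by (auto elim!: eventually_mono simp: k_def)
  qed
  have dens: "density G (\<lambda>x. ennreal (k x)) = F"
  proof (rule measure_eqI)
    show "sets (density G (\<lambda>x. ennreal (k x))) = sets F" by (simp add: sG sF)
    fix A assume "A \<in> sets (density G (\<lambda>x. ennreal (k x)))"
    then have A[measurable]: "A \<in> sets borel" by (simp add: sG)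
    have "emeasure (density G (\<lambda>x. ennreal (k x))) A = (\<integral>\<^sup>+x. ennreal (k x) * indicator A x \<partial>G)"
      by (subst emeasure_density) (auto simp: sG)
    also have "\<dots> = (\<integral>\<^sup>+x. ennreal (1 / w x) * (ennreal (k x) * indicator A x) \<partial>F)"
      by (subst G) (auto simp: k_def)
    also have "\<dots> = (\<integral>\<^sup>+x. indicator A x \<partial>F)"
    proof (rule nn_integral_cong_AE)
      show "AE x in F. ennreal (1 / w x) * (ennreal (k x) * indicator A x) = indicator A x"
        using k by eventually_elim (simp add: mult.assoc[symmetric] ennreal_mult'[symmetric])
    qed
    also have "\<dots> = emeasure F A"
      by (simp add: sF)
    finally show "emeasure (density G (\<lambda>x. ennreal (k x))) A = emeasure F A" .
  qed
  have ac: "absolutely_continuous G F"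
    using absolutely_continuousI_density[of "\<lambda>x. ennreal (k x)" G] dens by simp
  have "AE x in G. ennreal (k x) = RN_deriv G F x"
    by (rule G.RN_deriv_unique[OF _ dens]) simp
  then have "AE x in F. ennreal (k x) = RN_deriv G F x"
    using absolutely_continuous_AE[OF _ ac] by (simp add: sF sG)
  with k have ent: "AE x in F. entropy_density (exp 1) G F x = ln (w x)"
    by eventually_elim (simp add: entropy_density_def log_def, metis enn2real_ennreal less_imp_le)
  then have "KL F G = ereal (\<integral>x. ln (w x) \<partial>F)"
  proof -
    have m: "entropy_density (exp 1) G F \<in> borel_measurable F"
      using measurable_entropy_density[where b = "exp 1" and M = G and N = F]
        measurable_unit_dists[OF F] measurable_unit_dists[OF Gd] by blast
    have "integrable F (entropy_density (exp 1) G F)"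
      using int m ent by (subst integrable_cong_AE) auto
    moreover have "KL_divergence (exp 1) G F = (\<integral>x. ln (w x) \<partial>F)"
      unfolding KL_divergence_def using m ent by (intro integral_cong_AE) auto
    ultimately show ?thesis
      using ac by (simp add: KL_def)
  qed
  then show ?thesis
    unfolding D_min_def using Gd meanG by (intro INF_lower2[of G]) auto
qed

lemma nn_integral_unit_dists:
  assumes F: "F \<in> unit_dists" and f: "integrable F f" and nn: "\<And>x. 0 \<le> x \<Longrightarrow> x \<le> 1 \<Longrightarrow> 0 \<le> f x"
  shows "(\<integral>\<^sup>+x. ennreal (f x) \<partial>F) = ennreal (\<integral>x. f x \<partial>F)"
proof (rule nn_integral_eq_integral[OF f])
  show "AE x in F. 0 \<le> f x"
    using unit_distsD(4)[OF F] by eventually_elim (use nn in auto)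
qed

lemma D_min_le_dual:
  assumes F: "F \<in> unit_dists" and \<mu>: "0 \<le> \<mu>" "\<mu> < 1"
    and le: "\<And>t. 0 \<le> t \<Longrightarrow> t < 1 \<Longrightarrow> ereal (\<integral>x. ln (1 - t * ((x - \<mu>) / (1 - \<mu>))) \<partial>F) \<le> c"
  shows "D_min F \<mu> \<le> c"
proof -
  interpret F: prob_space F using unit_distsD[OF F] by simp
  note [measurable_cong] = unit_distsD(2)[OF F]
  define v where "v x = (x - \<mu>) / (1 - \<mu>)" for x :: real
  define u where "u t = (\<integral>x. 1 / (1 - t * v x) \<partial>F)" for t
  define K where "K = 1 / (1 - \<mu>)"
  have [measurable]: "v \<in> borel_measurable borel"
    unfolding v_def by measurable
  have K: "0 < K" using \<mu> by (simp add: K_def)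
  have w_ge: "1 - t \<le> 1 - t * v x" and w_pos: "0 < 1 - t * v x" and v_le: "\<bar>v x\<bar> \<le> K"
    if "0 \<le> t" "t < 1" "0 \<le> x" "x \<le> 1" for t x
    using linear_bounds[OF \<mu> that] that unfolding v_def K_def by auto
  have int_v: "integrable F v"
    by (rule integrable_unit_dists[OF F, where B = K]) (auto intro: v_le[of 0])
  have int_u: "integrable F (\<lambda>x. 1 / (1 - t * v x))" if "0 \<le> t" "t < 1" for t
  proof (rule integrable_unit_dists[OF F, where B = "1 / (1 - t)"])
    fix x :: real assume x: "0 \<le> x" "x \<le> 1"
    show "\<bar>1 / (1 - t * v x)\<bar> \<le> 1 / (1 - t)"
      using w_ge[OF that x] w_pos[OF that x] that by (simp add: frac_le)
  qed simp
  have AE_pos: "AE x in F. 0 < 1 - t * v x" if "0 \<le> t" "t < 1" for t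
    using unit_distsD(4)[OF F] by eventually_elim (use w_pos[OF that] in auto)
  have nn_u: "(\<integral>\<^sup>+x. ennreal (1 / (1 - t * v x)) \<partial>F) = ennreal (u t)" if "0 \<le> t" "t < 1" for t
    unfolding u_def using w_pos[OF that]
    by (intro nn_integral_unit_dists[OF F int_u[OF that]]) (simp add: less_imp_le)
  have le': "ereal (\<integral>x. ln (1 - t * v x) \<partial>F) \<le> c" if "0 \<le> t" "t < 1" for t
    using le[OF that] by (simp add: v_def)
  have cont: "continuous_on {0..b} u" if b: "b < 1" for b
  proof (rule continuous_on_sequentiallyI)
    fix s :: "nat \<Rightarrow> real" and a
    assume s: "\<forall>n. s n \<in> {0..b}" "a \<in> {0..b}" "s \<longlonglongrightarrow> a"
    show "(\<lambda>n. u (s n)) \<longlonglongrightarrow> u a"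
      unfolding u_def
    proof (rule integral_dominated_convergence)
      show "AE x in F. (\<lambda>n. 1 / (1 - s n * v x)) \<longlonglongrightarrow> 1 / (1 - a * v x)"
        using AE_pos[of a] s b by (auto elim!: eventually_mono intro!: tendsto_intros)
      show "AE x in F. norm (1 / (1 - s n * v x)) \<le> 1 / (1 - b)" for n
        using unit_distsD(4)[OF F]
      proof eventually_elim
        case (elim x)
        have "0 \<le> s n" "s n \<le> b" using s(1) by auto
        then show ?case
          using w_ge[of "s n" x] elim b by (auto intro!: frac_le)
      qed
    qed auto
  qed
  consider (interior) t where "0 < t" "t < 1" "u t = 1" | (mean) "0 \<le> (\<integral>x. v x \<partial>F)"
    | (boundary) "\<And>t. 0 < t \<Longrightarrow> t < 1 \<Longrightarrow> u t \<le> 1"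
  proof (cases "(\<exists>t. 0 < t \<and> t < 1 \<and> u t = 1) \<or> 0 \<le> (\<integral>x. v x \<partial>F)")
    case True
    then show thesis using that by blast
  next
    case False
    define \<delta> where "\<delta> = - (\<integral>x. v x \<partial>F)"
    have \<delta>: "0 < \<delta>" using False by (simp add: \<delta>_def)
    define t0 where "t0 = \<delta> / (\<delta> + K\<^sup>2 + 1)"
    have den: "0 < \<delta> + K\<^sup>2 + 1" using \<delta> by (simp add: add_pos_nonneg)
    have K1: "0 < K\<^sup>2 + 1" by (simp add: add_nonneg_pos)
    have t0: "0 < t0" "t0 < 1" using \<delta> den K1 by (auto simp: t0_def)
    have "1 - t0 = (K\<^sup>2 + 1) / (\<delta> + K\<^sup>2 + 1)"
      using den by (simp add: t0_def field_simps)
    then have "t0 * K\<^sup>2 / (1 - t0) = \<delta> * (K\<^sup>2 / (K\<^sup>2 + 1))"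
      using den K1 by (simp add: t0_def)
    also have "\<dots> < \<delta> * 1"
      using \<delta> K1 by (intro mult_strict_left_mono) (auto simp: divide_less_eq_1)
    finally have small: "t0 * K\<^sup>2 / (1 - t0) < \<delta>" by simp
    have "u t0 \<le> (\<integral>x. 1 + t0 * v x + t0\<^sup>2 * K\<^sup>2 / (1 - t0) \<partial>F)"
      unfolding u_def
    proof (rule integral_mono_unit_dists[OF F])
      fix x :: real assume x: "0 \<le> x" "x \<le> 1"
      note wp = w_pos[OF less_imp_le[OF t0(1)] t0(2) x]
      have "(v x)\<^sup>2 \<le> K\<^sup>2"
        using v_le[of 0 x] x K by (simp add: abs_le_square_iff[symmetric])
      then have "t0\<^sup>2 * (v x)\<^sup>2 / (1 - t0 * v x) \<le> t0\<^sup>2 * K\<^sup>2 / (1 - t0)"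
        using w_ge[OF less_imp_le[OF t0(1)] t0(2) x] t0 by (intro frac_le mult_left_mono) auto
      moreover have "1 / (1 - t0 * v x) = 1 + t0 * v x + t0\<^sup>2 * (v x)\<^sup>2 / (1 - t0 * v x)"
        using wp by (simp add: field_simps power2_eq_square)
      ultimately show "1 / (1 - t0 * v x) \<le> 1 + t0 * v x + t0\<^sup>2 * K\<^sup>2 / (1 - t0)" by simp
    qed (use int_u[of t0] t0 int_v in auto)
    also have "\<dots> = 1 + t0 * (t0 * K\<^sup>2 / (1 - t0) - \<delta>)"
      using int_v by (simp add: F.prob_space \<delta>_def algebra_simps power2_eq_square)
    also have "\<dots> < 1"
      using small t0 by (simp add: mult_pos_neg)
    finally have u0: "u t0 < 1" .
    have "u t \<le> 1" if t: "0 < t" "t < 1" for t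
    proof (rule ccontr)
      assume "\<not> u t \<le> 1"
      then have ut: "1 \<le> u t" by simp
      have "\<exists>s. 0 < s \<and> s < 1 \<and> u s = 1"
      proof (cases "t0 \<le> t")
        case True
        have "continuous_on {t0..t} u"
          by (rule continuous_on_subset[OF cont[OF t(2)]]) (use t0 in auto)
        from IVT'[OF less_imp_le[OF u0] ut True this] t0 t show ?thesis
          by (meson le_less_trans less_le_trans)
      next
        case False
        have "continuous_on {t..t0} u"
          by (rule continuous_on_subset[OF cont[OF t0(2)]]) (use t in auto)
        from IVT2'[OF less_imp_le[OF u0] ut _ this] False t0 t show ?thesis
          by (meson le_less_trans less_le_trans linear)
      qed
      with False show False by blast
    qed
    then show thesis by (rule that(3))
  qed
  then show ?thesis
  proof cases
    case (interior t)
    have t: "0 \<le> t" "t < 1" using interior by auto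
    have int_m: "integrable F (\<lambda>x. (1 - \<mu>) / t * (1 - (1 - t) * (1 / (1 - t * v x))))"
      by (intro integrable_mult_right Bochner_Integration.integrable_diff int_u[OF t]) simp
    have "D_min F \<mu> \<le> ereal (\<integral>x. ln (1 - t * v x) \<partial>F)"
    proof (rule D_min_le_reweighted[OF F \<mu> _ AE_pos[OF t]])
      have eq: "(1 - x) / (1 - t * v x) = (1 - \<mu>) / t * (1 - (1 - t) * (1 / (1 - t * v x)))"
        if "0 \<le> x" "x \<le> 1" for x
      proof -
        have "1 - x = (1 - \<mu>) * (1 - v x)"
          using \<mu> by (simp add: v_def field_simps)
        then have "(1 - x) / (1 - t * v x) = (1 - \<mu>) * ((1 - v x) / (1 - t * v x))"
          by simp
        also have "(1 - v x) / (1 - t * v x) = 1 / t * (1 - (1 - t) * (1 / (1 - t * v x)))"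
          using w_pos[OF t that] interior(1) by (simp add: field_simps)
        finally show ?thesis by simp
      qed
      have "(\<integral>\<^sup>+x. ennreal ((1 - x) / (1 - t * v x)) \<partial>F)
        = (\<integral>\<^sup>+x. ennreal ((1 - \<mu>) / t * (1 - (1 - t) * (1 / (1 - t * v x)))) \<partial>F)"
      proof (rule nn_integral_cong_AE)
        show "AE x in F. ennreal ((1 - x) / (1 - t * v x))
          = ennreal ((1 - \<mu>) / t * (1 - (1 - t) * (1 / (1 - t * v x))))"
          using unit_distsD(4)[OF F] by eventually_elim (use eq in auto)
      qed
      also have "\<dots> = ennreal (\<integral>x. (1 - \<mu>) / t * (1 - (1 - t) * (1 / (1 - t * v x))) \<partial>F)"
      proof (rule nn_integral_unit_dists[OF F int_m])
        fix x :: real assume x: "0 \<le> x" "x \<le> 1"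
        show "0 \<le> (1 - \<mu>) / t * (1 - (1 - t) * (1 / (1 - t * v x)))"
          using eq[OF x] w_pos[OF t x] x by (metis diff_ge_0_iff_ge divide_nonneg_pos)
      qed
      also have "(\<integral>x. (1 - \<mu>) / t * (1 - (1 - t) * (1 / (1 - t * v x))) \<partial>F)
        = (1 - \<mu>) / t * (1 - (1 - t) * u t)"
      proof -
        have "(\<integral>x. k * (1 - s * h x) \<partial>F) = k * (1 - s * (\<integral>x. h x \<partial>F))"
          if "integrable F h" for k s and h :: "real \<Rightarrow> real"
          using that by (simp add: F.prob_space)
        from this[OF int_u[OF t]] show ?thesis unfolding u_def .
      qed
      also have "\<dots> = 1 - \<mu>"
        using interior by simp
      finally show "(\<integral>\<^sup>+x. ennreal ((1 - x) / (1 - t * v x)) \<partial>F) \<le> ennreal (1 - \<mu>)" by simp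
      show "integrable F (\<lambda>x. ln (1 - t * v x))"
        using ln_linear_integrable[OF F \<mu> t] by (simp add: v_def)
    qed (use nn_u[OF t] interior in auto)
    with le'[OF t] show ?thesis by simp
  next
    case mean
    have int1: "integrable F (\<lambda>x. 1 - x)"
      by (rule integrable_unit_dists[OF F, where B = 1]) auto
    have "(\<integral>x. v x \<partial>F) = (1 - \<mu> - (\<integral>x. 1 - x \<partial>F)) / (1 - \<mu>)"
    proof -
      have "(\<integral>x. v x \<partial>F) = (\<integral>x. (1 - \<mu> - (1 - x)) / (1 - \<mu>) \<partial>F)"
        by (simp add: v_def)
      also have "\<dots> = (1 - \<mu> - (\<integral>x. 1 - x \<partial>F)) / (1 - \<mu>)"
        using int1 by (simp only: integral_divide_zero)
          (subst Bochner_Integration.integral_diff, auto simp: F.prob_space)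
      finally show ?thesis .
    qed
    then have "(\<integral>x. 1 - x \<partial>F) \<le> 1 - \<mu>"
      using mean \<mu> by (simp add: zero_le_divide_iff)
    then have "(\<integral>\<^sup>+x. ennreal ((1 - x) / 1) \<partial>F) \<le> ennreal (1 - \<mu>)"
      using nn_integral_unit_dists[OF F int1] by (simp add: ennreal_leI)
    then have "D_min F \<mu> \<le> ereal (\<integral>x. ln 1 \<partial>F)"
      by (intro D_min_le_reweighted[OF F \<mu>]) (auto simp: F.emeasure_space_1)
    with le'[of 0] show ?thesis by simp
  next
    case boundary
    define s where "s n = 1 - 1 / real (n + 2)" for n
    have s: "0 < s n" "s n < 1" for n by (auto simp: s_def)
    have s_lim: "s \<longlonglongrightarrow> 1"
    proof -
      have "(\<lambda>n. 1 - 1 / real (n + 2)) \<longlonglongrightarrow> 1 - 0"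
        by (intro tendsto_intros LIMSEQ_ignore_initial_segment[OF lim_const_over_n])
      then show ?thesis by (simp add: s_def[abs_def])
    qed
    have v1: "0 \<le> 1 - v x" if "x \<le> 1" for x
      using that \<mu> by (simp add: v_def field_simps)
    have "(\<integral>\<^sup>+x. inverse (ennreal (1 - v x)) \<partial>F)
        = (\<integral>\<^sup>+x. liminf (\<lambda>n. ennreal (1 / (1 - s n * v x))) \<partial>F)"
    proof (rule nn_integral_cong_AE)
      show "AE x in F. inverse (ennreal (1 - v x)) = liminf (\<lambda>n. ennreal (1 / (1 - s n * v x)))"
        using unit_distsD(4)[OF F]
      proof eventually_elim
        case (elim x)
        have "(\<lambda>n. ennreal (1 - s n * v x)) \<longlonglongrightarrow> ennreal (1 - 1 * v x)"
          by (intro tendsto_ennrealI tendsto_intros s_lim)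
        then have "(\<lambda>n. inverse (ennreal (1 - s n * v x))) \<longlonglongrightarrow> inverse (ennreal (1 - 1 * v x))"
          by (rule continuous_on_tendsto_compose[OF continuous_on_inverse_ennreal[OF continuous_on_id[of UNIV]]])
            auto
        moreover have "inverse (ennreal (1 - s n * v x)) = ennreal (1 / (1 - s n * v x))" for n
          using w_pos[of "s n" x] s[of n] elim by (simp add: inverse_ennreal inverse_eq_divide less_imp_le)
        ultimately show ?case
          by (simp add: lim_imp_Liminf)
      qed
    qed
    also have "\<dots> \<le> liminf (\<lambda>n. \<integral>\<^sup>+x. ennreal (1 / (1 - s n * v x)) \<partial>F)"
      by (rule nn_integral_liminf) simp
    also have "\<dots> \<le> liminf (\<lambda>n. 1)"
      using s boundary by (intro Liminf_mono) (auto simp: nn_u less_imp_le)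
    also have "\<dots> = 1"
      by (simp add: Liminf_const)
    finally have fatou: "(\<integral>\<^sup>+x. inverse (ennreal (1 - v x)) \<partial>F) \<le> 1" .
    then have "AE x in F. inverse (ennreal (1 - v x)) \<noteq> \<infinity>"
      by (intro nn_integral_PInf_AE) (auto simp: top_unique)
    then have pos: "AE x in F. 0 < 1 - v x"
      using unit_distsD(4)[OF F]
    proof eventually_elim
      case (elim x)
      then show ?case using v1[of x] by (cases "v x = 1") auto
    qed
    have ne1: "AE x in F. x \<noteq> 1"
      using pos by eventually_elim (use \<mu> in \<open>auto simp: v_def\<close>)
    have mass: "(\<integral>\<^sup>+x. ennreal (1 / (1 - v x)) \<partial>F) \<le> 1"
    proof -
      have "(\<integral>\<^sup>+x. ennreal (1 / (1 - v x)) \<partial>F) = (\<integral>\<^sup>+x. inverse (ennreal (1 - v x)) \<partial>F)"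
      proof (rule nn_integral_cong_AE)
        show "AE x in F. ennreal (1 / (1 - v x)) = inverse (ennreal (1 - v x))"
          using pos by eventually_elim (simp add: inverse_ennreal inverse_eq_divide)
      qed
      with fatou show ?thesis by simp
    qed
    have int_inv: "integrable F (\<lambda>x. 1 / (1 - v x))"
    proof (rule integrableI_nonneg)
      show "AE x in F. 0 \<le> 1 / (1 - v x)"
        using pos by eventually_elim simp
      show "(\<integral>\<^sup>+x. ennreal (1 / (1 - v x)) \<partial>F) < \<infinity>"
        using mass by (rule le_less_trans) simp
    qed simp
    have int_ln: "integrable F (\<lambda>x. ln (1 - v x))"
    proof (rule Bochner_Integration.integrable_bound)
      show "integrable F (\<lambda>x. (1 - v x) + 1 / (1 - v x))"
        using int_v int_inv by auto
      show "AE x in F. norm (ln (1 - v x)) \<le> norm ((1 - v x) + 1 / (1 - v x))"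
        using pos
      proof eventually_elim
        case (elim x)
        have "ln (1 - v x) \<le> 1 - v x - 1" "ln (1 / (1 - v x)) \<le> 1 / (1 - v x) - 1"
          using elim by (intro ln_le_minus_one; simp)+
        moreover have "ln (1 / (1 - v x)) = - ln (1 - v x)"
          using elim by (simp add: ln_div)
        moreover have "0 < 1 / (1 - v x)"
          using elim by simp
        ultimately show ?case
          using elim unfolding real_norm_def abs_le_iff by linarith
      qed
    qed simp
    have "D_min F \<mu> \<le> ereal (\<integral>x. ln (1 - v x) \<partial>F)"
    proof (rule D_min_le_reweighted[OF F \<mu> _ pos mass disjI2[OF ne1] _ int_ln])
      have "(\<integral>\<^sup>+x. ennreal ((1 - x) / (1 - v x)) \<partial>F) = (\<integral>\<^sup>+x. ennreal (1 - \<mu>) \<partial>F)"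
      proof (rule nn_integral_cong_AE)
        show "AE x in F. ennreal ((1 - x) / (1 - v x)) = ennreal (1 - \<mu>)"
          using ne1
        proof eventually_elim
          case (elim x)
          have "1 - v x = (1 - x) / (1 - \<mu>)"
            using \<mu> by (simp add: v_def field_simps)
          then show ?case using elim \<mu> by simp
        qed
      qed
      then show "(\<integral>\<^sup>+x. ennreal ((1 - x) / (1 - v x)) \<partial>F) \<le> ennreal (1 - \<mu>)"
        by (simp add: F.emeasure_space_1)
    qed simp
    also have "\<dots> \<le> c"
    proof (rule LIMSEQ_le_const2)
      show "(\<lambda>n. ereal (s n * (\<integral>x. ln (1 - v x) \<partial>F))) \<longlonglongrightarrow> ereal (\<integral>x. ln (1 - v x) \<partial>F)"
        using tendsto_mult[OF s_lim tendsto_const[of "\<integral>x. ln (1 - v x) \<partial>F"]] by simp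
      have "ereal (s n * (\<integral>x. ln (1 - v x) \<partial>F)) \<le> c" for n
      proof -
        have "s n * (\<integral>x. ln (1 - v x) \<partial>F) = (\<integral>x. s n * ln (1 - v x) \<partial>F)"
          by simp
        also have "\<dots> \<le> (\<integral>x. ln (1 - s n * v x) \<partial>F)"
        proof (rule integral_mono_AE)
          show "AE x in F. s n * ln (1 - v x) \<le> ln (1 - s n * v x)"
            using pos
          proof eventually_elim
            case (elim x)
            have "(1 - s n) * ln 1 + s n * ln (1 - v x) \<le> ln ((1 - s n) * 1 + s n * (1 - v x))"
              using elim s[of n] concave_onD[OF ln_concave, of "s n" 1 "1 - v x"] by simp
            then show ?case by (simp add: algebra_simps)
          qed
          show "integrable F (\<lambda>x. ln (1 - s n * v x))"
            using ln_linear_integrable[OF F \<mu>, of "s n"] s[of n] by (simp add: v_def)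
        qed (use int_ln in simp)
        finally show ?thesis
          using le'[of "s n"] s[of n] by (meson ereal_less_eq(3) less_imp_le order_trans)
      qed
      then show "\<exists>N. \<forall>n\<ge>N. ereal (s n * (\<integral>x. ln (1 - v x) \<partial>F)) \<le> c" by blast
    qed
    finally show ?thesis .
  qed
qed

subsection \<open>Comparison of the dual objectives\<close>

lemma integral_ln_one_minus_sums:
  assumes F: "F \<in> unit_dists" and r: "0 \<le> r" "r < 1"
  shows "(\<lambda>k. - (r ^ k / real k) * (\<integral>x. x ^ k \<partial>F)) sums (\<integral>x. ln (1 - r * x) \<partial>F)"
proof -
  interpret prob_space F using unit_distsD[OF F] by simp
  note [measurable_cong] = unit_distsD(2)[OF F]
  define g where "g k x = - (r ^ k / real k) * x ^ k" for k and x :: real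
  have sums: "(\<lambda>k. g k x) sums ln (1 - r * x)" and le: "norm (g k x) \<le> r ^ k"
    if x: "0 \<le> x" "x \<le> 1" for x k
  proof -
    have rx: "0 \<le> r * x" "r * x \<le> r"
      using x r by (auto intro: mult_left_le)
    then have "(\<lambda>k. - ((- (- (r * x))) ^ k) / real k) sums ln (1 + - (r * x))"
      using r by (intro ln_series') auto
    then show "(\<lambda>k. g k x) sums ln (1 - r * x)"
      by (simp add: g_def power_mult_distrib)
    have "norm (g k x) = (r ^ k * x ^ k) / real k"
      using x r by (simp add: g_def abs_mult)
    also have "\<dots> \<le> r ^ k * x ^ k"
      using x r divide_left_mono[of 1 "real k" "r ^ k * x ^ k"] by (cases "k = 0") auto
    also have "\<dots> \<le> r ^ k"
      using x r by (intro mult_left_le power_le_one) auto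
    finally show "norm (g k x) \<le> r ^ k" .
  qed
  have sr: "summable (\<lambda>k. r ^ k)"
    using r by (intro summable_geometric) simp
  have int: "integrable F (g k)" for k
    using le by (intro integrable_unit_dists[OF F]) (auto simp: g_def[abs_def])
  have "(\<lambda>k. \<integral>x. g k x \<partial>F) sums (\<integral>x. (\<Sum>k. g k x) \<partial>F)"
  proof (rule sums_integral[OF int])
    show "AE x in F. summable (\<lambda>k. norm (g k x))"
      using unit_distsD(4)[OF F]
      by eventually_elim (use le in \<open>auto intro!: summable_comparison_test[OF _ sr]\<close>)
    have "(\<integral>x. norm (g k x) \<partial>F) \<le> r ^ k" for k
      using integral_mono_unit_dists[OF F integrable_norm[OF int[of k]], of "\<lambda>_. r ^ k"] le
      by (simp add: prob_space)
    then show "summable (\<lambda>k. \<integral>x. norm (g k x) \<partial>F)"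
      by (intro summable_comparison_test[OF _ sr]) auto
  qed
  also have "(\<integral>x. (\<Sum>k. g k x) \<partial>F) = (\<integral>x. ln (1 - r * x) \<partial>F)"
  proof (rule integral_cong_AE)
    show "AE x in F. (\<Sum>k. g k x) = ln (1 - r * x)"
      using unit_distsD(4)[OF F] by eventually_elim (use sums in \<open>auto simp: sums_iff\<close>)
  qed (auto simp: g_def[abs_def])
  finally show ?thesis
    by (simp add: g_def)
qed

lemma integral_ln_linear_mono:
  assumes F: "F \<in> unit_dists" and G: "G \<in> unit_dists"
    and m: "\<And>k. (\<integral>x. x ^ k \<partial>G) \<le> (\<integral>x. x ^ k \<partial>F)"
    and \<mu>: "0 \<le> \<mu>" "\<mu> < 1" and t: "0 \<le> t" "t < 1"
  shows "(\<integral>x. ln (1 - t * ((x - \<mu>) / (1 - \<mu>))) \<partial>F) \<le> (\<integral>x. ln (1 - t * ((x - \<mu>) / (1 - \<mu>))) \<partial>G)"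
proof -
  define a where "a = (1 - \<mu> + t * \<mu>) / (1 - \<mu>)"
  define r where "r = t / (1 - \<mu> + t * \<mu>)"
  have den: "0 < 1 - \<mu> + t * \<mu>"
    using \<mu> t by (simp add: add_pos_nonneg)
  have a: "0 < a"
    using \<mu> den by (simp add: a_def)
  have "0 < (1 - t) * (1 - \<mu>)" using \<mu> t by simp
  then have "t < 1 - \<mu> + t * \<mu>" by (simp add: algebra_simps)
  then have r: "0 \<le> r" "r < 1"
    using den t by (auto simp: r_def)
  have eq: "(\<integral>x. ln (1 - t * ((x - \<mu>) / (1 - \<mu>))) \<partial>H) = ln a + (\<integral>x. ln (1 - r * x) \<partial>H)"
    if H: "H \<in> unit_dists" for H
  proof -
    interpret prob_space H using unit_distsD[OF H] by simp
    note [measurable_cong] = unit_distsD(2)[OF H]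
    have int: "integrable H (\<lambda>x. ln (1 - r * x))"
      using ln_linear_integrable[OF H order.refl zero_less_one r] by simp
    have "(\<integral>x. ln (1 - t * ((x - \<mu>) / (1 - \<mu>))) \<partial>H) = (\<integral>x. ln a + ln (1 - r * x) \<partial>H)"
    proof (rule integral_cong_AE)
      show "AE x in H. ln (1 - t * ((x - \<mu>) / (1 - \<mu>))) = ln a + ln (1 - r * x)"
        using unit_distsD(4)[OF H]
      proof eventually_elim
        case (elim x)
        have "r * x \<le> r" using elim r by (auto intro: mult_left_le)
        then have "0 < 1 - r * x" using r by linarith
        moreover have "a * r = t / (1 - \<mu>)" "a = 1 + t * \<mu> / (1 - \<mu>)"
          using den \<mu> by (simp add: a_def r_def, simp add: a_def field_simps)
        then have "1 - t * ((x - \<mu>) / (1 - \<mu>)) = a - (a * r) * x"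
          by (simp add: diff_divide_distrib right_diff_distrib)
        then have "1 - t * ((x - \<mu>) / (1 - \<mu>)) = a * (1 - r * x)"
          by (simp add: right_diff_distrib)
        ultimately show ?case using a by (simp add: ln_mult)
      qed
    qed auto
    also have "\<dots> = ln a + (\<integral>x. ln (1 - r * x) \<partial>H)"
      using int by (simp add: prob_space)
    finally show ?thesis .
  qed
  have "(\<integral>x. ln (1 - r * x) \<partial>F) \<le> (\<integral>x. ln (1 - r * x) \<partial>G)"
  proof (rule sums_le[OF _ integral_ln_one_minus_sums[OF F r] integral_ln_one_minus_sums[OF G r]])
    show "- (r ^ k / real k) * (\<integral>x. x ^ k \<partial>F) \<le> - (r ^ k / real k) * (\<integral>x. x ^ k \<partial>G)" for k
      using m[of k] r by (intro mult_left_mono_neg) auto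
  qed
  then show ?thesis
    using eq[OF F] eq[OF G] by simp
qed

lemma D_min_mono_moments:
  assumes F: "F \<in> unit_dists" and G: "G \<in> unit_dists"
    and m: "\<And>k. (\<integral>x. x ^ k \<partial>G) \<le> (\<integral>x. x ^ k \<partial>F)"
    and \<mu>: "0 \<le> \<mu>" "\<mu> < 1"
  shows "D_min F \<mu> \<le> D_min G \<mu>"
proof (rule D_min_le_dual[OF F \<mu>])
  fix t :: real assume t: "0 \<le> t" "t < 1"
  show "ereal (\<integral>x. ln (1 - t * ((x - \<mu>) / (1 - \<mu>))) \<partial>F) \<le> D_min G \<mu>"
    using integral_ln_linear_mono[OF F G m \<mu> t] D_min_ge_dual[OF G \<mu> t]
    by (meson ereal_less_eq(3) order_trans)
qed

subsection \<open>Existence of the lower distribution\<close>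

lemma enumerate_finite_real:
  fixes S :: "real set"
  assumes "finite S"
  shows "\<exists>x. strict_mono_on {1..card S} x \<and> x ` {1..card S} = S"
proof -
  define xs where "xs = sorted_list_of_set S"
  have xs: "sorted_wrt (<) xs" "set xs = S" "length xs = card S"
    using assms by (auto simp: xs_def)
  have "strict_mono_on {1..card S} (\<lambda>i. xs ! (i - 1))"
  proof (rule strict_mono_onI)
    fix i j assume "i \<in> {1..card S}" "j \<in> {1..card S}" "i < j"
    then show "xs ! (i - 1) < xs ! (j - 1)"
      using xs by (intro sorted_wrt_nth_less[OF xs(1)]) auto
  qed
  moreover have "(\<lambda>i. xs ! (i - 1)) ` {1..card S} = S"
  proof -
    have "(\<lambda>i. xs ! (i - 1)) ` {1..card S} = (\<lambda>i. xs ! i) ` {0..<length xs}"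
      using xs(3) by (force simp: image_iff Bex_def intro: exI[of _ "Suc _"])
    then show ?thesis
      using xs(2) by (auto simp: set_conv_nth)
  qed
  ultimately show ?thesis by blast
qed

lemma is_lower_distI:
  assumes S: "S \<subseteq> {0..1}" "card S = l" "0 < l" and ev: "even d \<Longrightarrow> 0 \<in> S"
    and f: "\<And>y. y \<in> S \<Longrightarrow> 0 \<le> f y"
    and m: "\<And>m. m \<le> d \<Longrightarrow> (\<Sum>y\<in>S. f y * y ^ m) = M m" and M0: "M 0 = 1"
  shows "\<exists>F. is_lower_dist d l M F"
proof -
  have fin: "finite S" using S card_ge_0_finite by blast
  obtain x where x: "strict_mono_on {1..l} x" "x ` {1..l} = S"
    using enumerate_finite_real[OF fin] S(2) by auto
  have inj: "inj_on x {1..l}"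
    using x(1) by (rule strict_mono_on_imp_inj_on)
  have sum: "(\<Sum>i=1..l. g (x i)) = (\<Sum>y\<in>S. g y)" for g :: "real \<Rightarrow> real"
    using sum.reindex[OF inj, of g] x(2) by simp
  have xS: "x i \<in> S" if "i \<in> {1..l}" for i
    using x(2) that by blast
  obtain F where F: "F \<in> unit_dists" "is_atomic_sum l (\<lambda>i. f (x i)) x F"
  proof -
    have "(\<Sum>i=1..l. f (x i)) = 1"
      using m[of 0] M0 sum[of f] by simp
    then have "\<exists>F\<in>unit_dists. is_atomic_sum l (\<lambda>i. f (x i)) x F"
      using f xS S(1) by (intro ex_atomic_sum) blast+
    then show ?thesis using that by blast
  qed
  have "x 1 \<in> S" "x l \<in> S" using xS S(3) by auto
  have "x 1 = 0" if d: "even d"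
  proof -
    obtain i where "i \<in> {1..l}" "x i = 0" using ev[OF d] x(2) by auto
    then have "x 1 \<le> 0"
      using strict_mono_on_leD[OF x(1), of 1 i] by auto
    with \<open>x 1 \<in> S\<close> S show ?thesis by force
  qed
  moreover have "(\<Sum>i=1..l. f (x i) * x i ^ m) = M m" if "m \<le> d" for m
    using m[OF that] sum[of "\<lambda>y. f y * y ^ m"] by simp
  ultimately have "is_lower_dist d l M F"
    unfolding is_lower_dist_def
  proof (intro conjI exI)
    show "0 \<le> x 1" "x l \<le> 1"
      using \<open>x 1 \<in> S\<close> \<open>x l \<in> S\<close> S(1) by auto
  qed (use F x S f xS in auto)
  then show ?thesis ..
qed

lemma lower_dist_of_finite_support:
  assumes F: "F \<in> unit_dists" and S: "finite S" "card S \<le> l" and ae: "AE x in F. x \<in> S"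
    and l: "0 < l" and ev: "even d \<Longrightarrow> 0 \<in> S"
    and m: "\<And>m. m \<le> d \<Longrightarrow> (\<integral>x. x ^ m \<partial>F) = M m" and M0: "M 0 = 1"
  shows "\<exists>G. is_lower_dist d l M G"
proof -
  interpret prob_space F using unit_distsD[OF F] by simp
  note [measurable_cong] = unit_distsD(2)[OF F]
  have "card (S \<inter> {0..1}) \<le> l"
    using S card_mono[of S "S \<inter> {0..1}"] by auto
  then obtain T where T: "S \<inter> {0..1} \<subseteq> T" "T \<subseteq> {0..1}" "card T = l"
  proof -
    have "infinite ({0..1::real} - S \<inter> {0..1})"
      using S by (intro Diff_infinite_finite) (auto simp: infinite_Icc)
    then obtain B where B: "finite B" "card B = l - card (S \<inter> {0..1})" "B \<subseteq> {0..1} - S \<inter> {0..1}"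
      using infinite_arbitrarily_large by blast
    then have "card (S \<inter> {0..1} \<union> B) = l"
      using S \<open>card (S \<inter> {0..1}) \<le> l\<close> by (subst card_Un_disjoint) auto
    with B show ?thesis by (intro that[of "S \<inter> {0..1} \<union> B"]) auto
  qed
  have fin: "finite T" using T l card_ge_0_finite by blast
  have aeT: "AE x in F. x \<in> T"
    using ae unit_distsD(4)[OF F] by eventually_elim (use T in auto)
  have ind: "integrable F (indicat_real {y})" for y
    by (rule integrable_unit_dists[OF F, where B = 1]) (auto simp: indicator_def)
  have "(\<integral>x. x ^ k \<partial>F) = (\<Sum>y\<in>T. measure F {y} * y ^ k)" for k
  proof -
    have "(\<integral>x. x ^ k \<partial>F) = (\<integral>x. (\<Sum>y\<in>T. indicator {y} x * y ^ k) \<partial>F)"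
    proof (rule integral_cong_AE)
      show "AE x in F. x ^ k = (\<Sum>y\<in>T. indicator {y} x * y ^ k)"
        using aeT
      proof eventually_elim
        case (elim x)
        have "(\<Sum>y\<in>T. indicator {y} x * y ^ k) = (\<Sum>y\<in>T. if y = x then y ^ k else 0)"
          by (intro sum.cong) (auto simp: indicator_def)
        with elim fin show ?case by simp
      qed
    qed auto
    also have "\<dots> = (\<Sum>y\<in>T. measure F {y} * y ^ k)"
      using unit_distsD(2,3)[OF F] ind by (subst Bochner_Integration.integral_sum) auto
    finally show ?thesis .
  qed
  then show ?thesis
    using T l ev m M0
    by (intro is_lower_distI[of T l d "\<lambda>y. measure F {y}"]) (auto 4 4)
qed

lemma prod_linear_dvd:
  fixes p :: "'a::idom poly"
  assumes "finite S" "\<And>s. s \<in> S \<Longrightarrow> poly p s = 0"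
  shows "(\<Prod>s\<in>S. [:- s, 1:]) dvd p"
  using assms
proof (induction arbitrary: p)
  case (insert a S)
  have "poly p a = 0" using insert.prems by simp
  then obtain q where q: "p = [:- a, 1:] * q"
    unfolding poly_eq_0_iff_dvd by (rule dvdE)
  have "poly q s = 0" if "s \<in> S" for s
    using insert.prems[of s] insert.hyps that by (auto simp: q)
  then have "(\<Prod>s\<in>S. [:- s, 1:]) dvd q"
    by (rule insert.IH)
  then show ?case
    unfolding q prod.insert[OF insert.hyps] by (intro mult_dvd_mono dvd_refl)
qed simp

text \<open>
  By orthogonality to the node polynomial, interpolation in \<open>S\<close> integrates degree \<open>d\<close> exactly.
  The test polynomials make the interpolation weights nonnegative.
\<close>

lemma lower_dist_of_quadrature:
  fixes S :: "real set"
  defines "N \<equiv> \<Prod>s\<in>S. [:- s, 1:]"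
  assumes F: "F \<in> unit_dists" and S: "S \<subseteq> {0..1}" "card S = l" "0 < l" and ev: "even d \<Longrightarrow> 0 \<in> S"
    and orth: "\<And>q. degree q + l \<le> d \<Longrightarrow> (\<integral>x. poly N x * poly q x \<partial>F) = 0"
    and test: "\<And>y. y \<in> S \<Longrightarrow> \<exists>T. degree T \<le> d \<and> 0 < poly T y \<and> (\<forall>s\<in>S - {y}. poly T s = 0)
      \<and> (\<forall>x\<in>{0..1}. 0 \<le> poly T x)"
    and m: "\<And>m. m \<le> d \<Longrightarrow> (\<integral>x. x ^ m \<partial>F) = M m" and M0: "M 0 = 1"
    and ld: "l \<le> Suc d"
  shows "\<exists>G. is_lower_dist d l M G"
proof -
  have fin: "finite S" using S card_ge_0_finite by blast
  have "\<exists>p. degree p \<le> l - 1 \<and> (\<forall>s\<in>S. poly p s = (if s = y then 1 else 0))" for y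
    using poly_interpolation[OF fin, of "\<lambda>s. if s = y then 1 else 0"] S(2) by simp
  then obtain B where B: "\<And>y. degree (B y) \<le> l - 1" "\<And>y s. s \<in> S \<Longrightarrow> poly (B y) s = (if s = y then 1 else 0)"
    by metis
  define f where "f y = (\<integral>x. poly (B y) x \<partial>F)" for y
  have degN: "degree N = l" "N \<noteq> 0"
    using fin S(2) by (auto simp: N_def degree_prod_eq_sum_degree)
  have quad: "(\<integral>x. poly p x \<partial>F) = (\<Sum>y\<in>S. f y * poly p y)" if p: "degree p \<le> d" for p
  proof -
    define r where "r = (\<Sum>y\<in>S. smult (poly p y) (B y))"
    have r: "poly r s = poly p s" if s: "s \<in> S" for s
    proof -
      have "poly r s = (\<Sum>y\<in>S. if s = y then poly p y else 0)"
        unfolding r_def poly_sum using B(2)[OF s] by (intro sum.cong) auto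
      with s fin show ?thesis by simp
    qed
    have degr: "degree r \<le> l - 1"
      unfolding r_def using B(1) by (intro degree_sum_le fin) (auto intro: order.trans[OF degree_smult_le])
    have "N dvd p - r"
    proof -
      have "poly (p - r) s = 0" if "s \<in> S" for s using r that by simp
      then show ?thesis
        unfolding N_def
        by (intro prod_linear_dvd fin)
    qed
    then obtain q where q: "p - r = N * q" by (elim dvdE)
    have pr: "p = N * q + r" using q by (simp add: algebra_simps)
    have "q = 0 \<or> degree q + l \<le> d"
    proof (cases "q = 0")
      case False
      then have "degree q + l = degree (p - r)"
        using degN by (simp add: q degree_mult_eq)
      also have "\<dots> \<le> d"
        using p degr ld by (intro degree_diff_le) auto
      finally show ?thesis by simp
    qed simp
    then have "(\<integral>x. poly N x * poly q x \<partial>F) = 0"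
      using orth by auto
    moreover have "poly (N * q) = (\<lambda>x. poly N x * poly q x)" "poly p = (\<lambda>x. poly (N * q) x + poly r x)"
      by (auto simp: pr)
    ultimately have "(\<integral>x. poly p x \<partial>F) = (\<integral>x. poly r x \<partial>F)"
      using integrable_poly_unit_dists[OF F, of "N * q"] integrable_poly_unit_dists[OF F, of r]
      by simp
    also have "\<dots> = (\<Sum>y\<in>S. f y * poly p y)"
    proof -
      have "poly r = (\<lambda>x. \<Sum>y\<in>S. poly p y * poly (B y) x)"
        by (auto simp: r_def poly_sum)
      then show ?thesis
        unfolding f_def using integrable_poly_unit_dists[OF F]
        by (simp add: Bochner_Integration.integral_sum mult.commute)
    qed
    finally show ?thesis .
  qed
  show ?thesis
  proof (rule is_lower_distI[where f = f, OF S ev])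
    fix y assume y: "y \<in> S"
    obtain T where T: "degree T \<le> d" "0 < poly T y" "\<And>s. s \<in> S - {y} \<Longrightarrow> poly T s = 0"
      "\<And>x. x \<in> {0..1} \<Longrightarrow> 0 \<le> poly T x"
      using test[OF y] by blast
    have "0 = (\<integral>x. 0 \<partial>F)" by simp
    also have "\<dots> \<le> (\<integral>x. poly T x \<partial>F)"
      using T by (intro integral_mono_unit_dists[OF F] integrable_poly_unit_dists[OF F]) auto
    also have "\<dots> = (\<Sum>s\<in>S. if s = y then f y * poly T y else 0)"
      using T by (subst quad) (auto intro!: sum.cong)
    also have "\<dots> = f y * poly T y"
      using fin y by simp
    finally show "0 \<le> f y"
      using T by (simp add: zero_le_mult_iff)
  next
    fix k assume "k \<le> d"
    then show "(\<Sum>y\<in>S. f y * y ^ k) = M k"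
      using quad[of "monom 1 k"] m[of k] by (simp add: poly_monom degree_monom_eq)
  qed (simp_all add: M0)
qed

lemma ex_minimal_nodes:
  fixes n :: nat
  assumes F: "F \<in> unit_dists"
  shows "\<exists>y. (\<forall>i. y i \<in> {0..1}) \<and> (\<forall>z. (\<forall>i. z i \<in> {0..1}) \<longrightarrow>
    (\<integral>x. x ^ e * (\<Prod>i<n. x - y i)\<^sup>2 \<partial>F) \<le> (\<integral>x. x ^ e * (\<Prod>i<n. x - z i)\<^sup>2 \<partial>F))"
proof -
  note [measurable_cong] = unit_distsD(2)[OF F]
  interpret prob_space F using unit_distsD[OF F] by simp
  define C where "C = (PiE UNIV (\<lambda>_. {0..1}) :: (nat \<Rightarrow> real) set)"
  have "compactin (product_topology (\<lambda>_. euclidean) UNIV) C"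
    unfolding C_def by (simp add: compactin_PiE)
  then have "compact C"
    by (simp add: euclidean_product_topology)
  moreover have "C \<noteq> {}"
  proof -
    have "(\<lambda>_. 0) \<in> C" unfolding C_def by (rule PiE_I) auto
    then show ?thesis by (metis equals0D)
  qed
  moreover have "continuous_on C (\<lambda>y :: nat \<Rightarrow> real. \<integral>x. x ^ e * (\<Prod>i<n. x - y i)\<^sup>2 \<partial>F)"
  proof (rule continuous_on_sequentiallyI)
    fix u a assume u: "\<forall>k. u k \<in> C" "a \<in> C" "u \<longlonglongrightarrow> a"
    have lim: "(\<lambda>k. u k i) \<longlonglongrightarrow> a i" for i
      by (rule continuous_on_tendsto_compose[OF continuous_on_product_coordinates u(3)]) auto
    show "(\<lambda>k. \<integral>x. x ^ e * (\<Prod>i<n. x - u k i)\<^sup>2 \<partial>F) \<longlonglongrightarrow> (\<integral>x. x ^ e * (\<Prod>i<n. x - a i)\<^sup>2 \<partial>F)"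
    proof (rule integral_dominated_convergence)
      show "AE x in F. (\<lambda>k. x ^ e * (\<Prod>i<n. x - u k i)\<^sup>2) \<longlonglongrightarrow> x ^ e * (\<Prod>i<n. x - a i)\<^sup>2"
        by (intro always_eventually allI tendsto_intros lim)
      show "AE x in F. norm (x ^ e * (\<Prod>i<n. x - u k i)\<^sup>2) \<le> 1" for k
        using unit_distsD(4)[OF F]
      proof eventually_elim
        case (elim x)
        have "u k \<in> PiE UNIV (\<lambda>_. {0..1})"
          using u(1) unfolding C_def by (rule spec)
        then have uk: "u k i \<in> {0..1}" for i
          by (rule PiE_mem) simp
        have "\<bar>x - u k i\<bar> \<le> 1" for i
          using elim uk[of i] unfolding abs_le_iff by auto
        then have "\<bar>\<Prod>i<n. x - u k i\<bar> \<le> 1"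
          by (simp add: abs_prod prod_le_1)
        then have "(\<Prod>i<n. x - u k i)\<^sup>2 \<le> 1"
          using abs_square_le_1 by blast
        then show ?case
          using elim by (simp add: abs_mult mult_le_one power_le_one)
      qed
    qed auto
  qed
  ultimately obtain y where y: "y \<in> C" "\<forall>z\<in>C. (\<integral>x. x ^ e * (\<Prod>i<n. x - y i)\<^sup>2 \<partial>F) \<le> (\<integral>x. x ^ e * (\<Prod>i<n. x - z i)\<^sup>2 \<partial>F)"
    using continuous_attains_inf[of C] by blast
  then show ?thesis
    by (intro exI[of _ y]) (auto simp: C_def PiE_iff)
qed

lemma degree_prod_linear:
  fixes a :: "'b \<Rightarrow> 'a::idom"
  shows "finite A \<Longrightarrow> degree (\<Prod>i\<in>A. [:- a i, 1:]) = card A"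
  by (subst degree_prod_eq_sum_degree) auto

text \<open>
  The nodes \<open>y\<close> minimise the norm of \<open>\<pi>\<close> in \<open>L\<^sup>2(x ^ e dF)\<close> over the cube. If the minimum is 0, then
  \<open>F\<close> itself is supported on the nodes. Otherwise stationarity in \<open>y i\<close> says that \<open>\<pi>\<close> is orthogonal
  to \<open>P i\<close>, and the \<open>P i\<close> span the polynomials of degree below \<open>n\<close>.
\<close>

lemma ex_lower_dist:
  assumes F: "F \<in> unit_dists" and d: "1 \<le> d" and l: "l = d div 2 + 1"
    and m: "\<And>m. m \<le> d \<Longrightarrow> (\<integral>x. x ^ m \<partial>F) = M m" and M0: "M 0 = 1"
  shows "\<exists>G. is_lower_dist d l M G"
proof -
  define e :: nat where "e = (if even d then 1 else 0)"
  define n where "n = l - e"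
  have n: "0 < n" "l = n + e" "Suc d = 2 * n + e"
    using d l by (auto simp: n_def e_def elim!: evenE oddE)
  define E :: "real poly" where "E = monom 1 e"
  define \<pi> where "\<pi> z = (\<Prod>i<n. [:- z i, 1:])" for z :: "nat \<Rightarrow> real"
  define L where "L p = (\<integral>x. poly p x \<partial>F)" for p
  note int = integrable_poly_unit_dists[OF F]
  have L_add: "L (p + q) = L p + L q" and L_diff: "L (p - q) = L p - L q"
    and L_smult: "L (smult c p) = c * L p" for p q c
  proof -
    have "poly (p + q) = (\<lambda>x. poly p x + poly q x)" "poly (p - q) = (\<lambda>x. poly p x - poly q x)"
      "poly (smult c p) = (\<lambda>x. c * poly p x)"
      by auto
    then show "L (p + q) = L p + L q" "L (p - q) = L p - L q" "L (smult c p) = c * L p"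
      unfolding L_def using int by simp_all
  qed
  have L_mono: "L p \<le> L q" if "\<And>x. 0 \<le> x \<Longrightarrow> x \<le> 1 \<Longrightarrow> poly p x \<le> poly q x" for p q
    unfolding L_def using that by (intro integral_mono_unit_dists[OF F] int)
  have \<Phi>: "L (E * (\<pi> z)\<^sup>2) = (\<integral>x. x ^ e * (\<Prod>i<n. x - z i)\<^sup>2 \<partial>F)" for z
  proof -
    have "poly (E * (\<pi> z)\<^sup>2) = (\<lambda>x. x ^ e * (\<Prod>i<n. x - z i)\<^sup>2)"
      unfolding E_def \<pi>_def by (auto simp: poly_monom poly_prod poly_power)
    then show ?thesis by (simp add: L_def)
  qed
  obtain y where y': "\<forall>i. y i \<in> {0..1}"
    and min': "\<forall>z. (\<forall>i. z i \<in> {0..1}) \<longrightarrow> L (E * (\<pi> y)\<^sup>2) \<le> L (E * (\<pi> z)\<^sup>2)"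
    using ex_minimal_nodes[OF F, of e n] unfolding \<Phi> by (elim exE conjE)
  have y: "y i \<in> {0..1}" for i
    using y' by (rule spec)
  have min: "L (E * (\<pi> y)\<^sup>2) \<le> L (E * (\<pi> z)\<^sup>2)" if "\<And>i. z i \<in> {0..1}" for z
    using min' that by blast
  define \<rho> where "\<rho> = L (E * (\<pi> y)\<^sup>2)"
  have nn: "0 \<le> poly (E * p\<^sup>2) x" if "0 \<le> x" for p x
    using that by (simp add: E_def poly_monom poly_power)
  have "L 0 \<le> \<rho>"
    unfolding \<rho>_def using nn by (intro L_mono) auto
  then consider "\<rho> = 0" | "0 < \<rho>"
    by (fastforce simp: L_def)
  then show ?thesis
  proof cases
    case 1
    have "AE x in F. poly (E * (\<pi> y)\<^sup>2) x = 0"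
    proof (subst integral_nonneg_eq_0_iff_AE[symmetric])
      show "AE x in F. 0 \<le> poly (E * (\<pi> y)\<^sup>2) x"
        using unit_distsD(4)[OF F] by eventually_elim (use nn in auto)
      show "(\<integral>x. poly (E * (\<pi> y)\<^sup>2) x \<partial>F) = 0"
        using 1 unfolding \<rho>_def L_def .
    qed (rule int)
    then have "AE x in F. x \<in> y ` {..<n} \<union> (if even d then {0} else {})"
    proof eventually_elim
      case (elim x)
      then have "x ^ e = 0 \<or> (\<exists>i<n. x = y i)"
        by (auto simp: E_def \<pi>_def poly_monom poly_prod poly_power)
      then show ?case
        by (auto simp: e_def split: if_splits)
    qed
    moreover have "card (y ` {..<n} \<union> (if even d then {0} else {})) \<le> l"
      using card_Un_le[of "y ` {..<n}" "if even d then {0} else {}"] card_image_le[of "{..<n}" y] n(2)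
      by (auto simp: e_def)
    ultimately show ?thesis
      using n m M0
      by (intro lower_dist_of_finite_support[OF F, of "y ` {..<n} \<union> (if even d then {0} else {})"])
         (auto split: if_splits)
  next
    case 2
    define P where "P i = (\<Prod>j\<in>{..<n} - {i}. [:- y j, 1:])" for i
    have \<pi>_upd: "\<pi> (y(i := c)) = [:- c, 1:] * P i" if "i < n" for i c
      unfolding \<pi>_def P_def using that
      by (subst prod.remove[of "{..<n}" i]) (auto intro!: prod.cong arg_cong2[where f = "(*)"])
    have \<pi>_y: "\<pi> y = [:- y i, 1:] * P i" if "i < n" for i
      using \<pi>_upd[OF that, of "y i"] by simp
    define A where "A i = L (E * (P i)\<^sup>2)" for i
    define B where "B i = L (E * [:0, 1:] * (P i)\<^sup>2)" for i
    define C where "C i = L (E * [:0, 1:]\<^sup>2 * (P i)\<^sup>2)" for i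
    have quad: "L (E * (\<pi> (y(i := c)))\<^sup>2) = C i - 2 * c * B i + c\<^sup>2 * A i" if "i < n" for i c
    proof -
      have lin: "[:- c, 1:] = [:0, 1:] - [:c:]" by simp
      have "E * (\<pi> (y(i := c)))\<^sup>2 = E * [:0, 1:]\<^sup>2 * (P i)\<^sup>2
          - smult (2 * c) (E * [:0, 1:] * (P i)\<^sup>2) + smult (c\<^sup>2) (E * (P i)\<^sup>2)"
        unfolding \<pi>_upd[OF that] lin
        by (rule poly_ext) (simp add: poly_power algebra_simps power2_eq_square)
      then show ?thesis
        by (simp only: L_add L_diff L_smult A_def B_def C_def)
    qed
    have low: "\<rho> \<le> C i - 2 * c * B i + c\<^sup>2 * A i" if "i < n" "c \<in> {0..1}" for i c
      using min[of "y(i := c)"] that y unfolding quad[OF that(1), symmetric] \<rho>_def by auto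
    have CB: "C i \<le> B i" for i
      unfolding C_def B_def
    proof (rule L_mono)
      fix x :: real assume x: "0 \<le> x" "x \<le> 1"
      then have "x * x \<le> x" by (intro mult_left_le)
      then have "x * x * poly (E * (P i)\<^sup>2) x \<le> x * poly (E * (P i)\<^sup>2) x"
        using nn[OF x(1), of "P i"] by (rule mult_right_mono)
      then show "poly (E * [:0, 1:]\<^sup>2 * (P i)\<^sup>2) x \<le> poly (E * [:0, 1:] * (P i)\<^sup>2) x"
        by (simp add: power2_eq_square ac_simps)
    qed
    have B_pos: "\<rho> \<le> B i" and A_pos: "\<rho> + B i \<le> A i" if "i < n" for i
      using low[OF that, of 0] low[OF that, of 1] CB[of i] by auto
    have yi: "y i = B i / A i" if "i < n" for i
    proof -
      have "0 < A i" "B i / A i \<in> {0..1}"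
        using B_pos[OF that] A_pos[OF that] 2 by auto
      have "C i - 2 * y i * B i + (y i)\<^sup>2 * A i = \<rho>"
        using quad[OF that, of "y i"] by (simp add: \<rho>_def)
      with low[OF that \<open>B i / A i \<in> {0..1}\<close>]
      have "(y i)\<^sup>2 * A i - 2 * y i * B i + (B i)\<^sup>2 / A i \<le> 0"
        using \<open>0 < A i\<close> by (simp add: power2_eq_square)
      moreover have "(y i)\<^sup>2 * A i - 2 * y i * B i + (B i)\<^sup>2 / A i = A i * (y i - B i / A i)\<^sup>2"
        using \<open>0 < A i\<close> by (simp add: power2_eq_square field_simps)
      ultimately have "(y i - B i / A i)\<^sup>2 \<le> 0"
        using \<open>0 < A i\<close> by (simp add: mult_le_0_iff)
      then show ?thesis by simp
    qed
    have y_pos: "0 < y i" and y_lt: "y i < 1" if "i < n" for i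
      using B_pos[OF that] A_pos[OF that] 2 by (auto simp: yi[OF that])
    have stat: "L (E * \<pi> y * P i) = 0" if "i < n" for i
    proof -
      have "E * \<pi> y * P i = E * [:0, 1:] * (P i)\<^sup>2 - smult (y i) (E * (P i)\<^sup>2)"
        unfolding \<pi>_y[OF that]
        by (rule poly_ext) (simp add: poly_power algebra_simps power2_eq_square)
      then have "L (E * \<pi> y * P i) = B i - y i * A i"
        by (simp only: L_diff L_smult A_def B_def)
      also have "\<dots> = 0"
        using A_pos[OF that] B_pos[OF that] 2 by (simp add: yi[OF that])
      finally show ?thesis .
    qed
    \<comment> \<open>Splitting a double node \<open>c\<close> into \<open>c + \<epsilon>\<close> and \<open>c - \<epsilon>\<close> would lower the minimum.\<close>
    have inj: "inj_on y {..<n}"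
    proof (rule inj_onI, rule ccontr)
      fix i j assume ij: "i \<in> {..<n}" "j \<in> {..<n}" "y i = y j" "i \<noteq> j"
      define c where "c = y i"
      define g where "g = (\<Prod>k\<in>{..<n} - {i} - {j}. [:- y k, 1:])"
      define G where "G = L (E * g\<^sup>2)"
      have "L 0 \<le> G"
        unfolding G_def using nn by (intro L_mono) auto
      then have G: "0 \<le> G" by (simp add: L_def)
      define \<epsilon> where "\<epsilon> = min (min c (1 - c)) (\<rho> / (G + 1))"
      have c: "0 < c" "c < 1"
        using y_pos[of i] y_lt[of i] ij by (auto simp: c_def)
      have \<epsilon>: "0 < \<epsilon>" "\<epsilon> \<le> c" "\<epsilon> \<le> 1 - c" "\<epsilon> \<le> \<rho> / (G + 1)"
        using c 2 G by (auto simp: \<epsilon>_def)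
      have "\<epsilon> * (G + 1) \<le> \<rho>"
        using \<epsilon>(4) G by (simp add: le_divide_eq)
      moreover have "\<epsilon> * (\<epsilon> * G) \<le> 1 * (\<epsilon> * G)"
        using \<epsilon> c G by (intro mult_right_mono) auto
      ultimately have "\<epsilon>\<^sup>2 * G < \<rho>"
        using \<epsilon>(1) by (simp add: power2_eq_square algebra_simps)
      then have small: "\<epsilon>\<^sup>2 * (\<epsilon>\<^sup>2 * G) < \<epsilon>\<^sup>2 * \<rho>"
        using \<epsilon>(1) by (intro mult_strict_left_mono) auto
      have Pi: "P i = [:- c, 1:] * g"
        unfolding P_def g_def using ij by (subst prod.remove[of _ j]) (auto simp: c_def)
      define z where "z = y(i := c + \<epsilon>, j := c - \<epsilon>)"
      have \<pi>_z: "\<pi> z = [:- (c + \<epsilon>), 1:] * ([:- (c - \<epsilon>), 1:] * g)"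
        unfolding \<pi>_def g_def using ij
        by (subst prod.remove[of _ i], simp, simp, subst prod.remove[of _ j])
           (auto simp: z_def intro!: prod.cong arg_cong2[where f = "(*)"])
      have \<pi>_y': "\<pi> y = [:- c, 1:] * ([:- c, 1:] * g)"
        using \<pi>_y[of i] ij Pi by (simp add: c_def)
      have "E * (\<pi> z)\<^sup>2 = E * (\<pi> y)\<^sup>2 - smult (2 * \<epsilon>\<^sup>2) (E * (P i)\<^sup>2) + smult (\<epsilon>\<^sup>2 * \<epsilon>\<^sup>2) (E * g\<^sup>2)"
        unfolding \<pi>_z \<pi>_y' Pi
        by (rule poly_ext) (simp add: poly_power algebra_simps power2_eq_square)
      then have "L (E * (\<pi> z)\<^sup>2) = \<rho> - 2 * \<epsilon>\<^sup>2 * A i + \<epsilon>\<^sup>2 * \<epsilon>\<^sup>2 * G"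
        by (simp only: L_add L_diff L_smult A_def \<rho>_def G_def)
      moreover have "\<epsilon>\<^sup>2 * \<rho> \<le> \<epsilon>\<^sup>2 * A i"
        using A_pos[of i] B_pos[of i] ij 2 by (intro mult_left_mono) auto
      moreover have "0 < \<epsilon>\<^sup>2 * \<rho>"
        using \<epsilon>(1) 2 by simp
      ultimately have "L (E * (\<pi> z)\<^sup>2) < \<rho>"
        using small by (simp add: mult.assoc)
      moreover have "\<rho> \<le> L (E * (\<pi> z)\<^sup>2)"
        unfolding \<rho>_def using y \<epsilon> c by (intro min) (auto simp: z_def)
      ultimately show False by simp
    qed
    define S where "S = y ` {..<n} \<union> (if even d then {0} else {})"
    have Z: "y ` {..<n} \<inter> (if even d then {0} else {}) = {}"
      using y_pos by force
    have card_S: "card S = l"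
      unfolding S_def using Z inj n(2) by (subst card_Un_disjoint) (auto simp: card_image e_def)
    have N: "(\<Prod>s\<in>S. [:- s, 1:]) = E * \<pi> y"
    proof -
      have "(\<Prod>s\<in>S. [:- s, 1:]) = (\<Prod>s\<in>y ` {..<n}. [:- s, 1:]) * (\<Prod>s\<in>(if even d then {0} else {}). [:- s, 1:])"
        unfolding S_def using Z by (intro prod.union_disjoint) auto
      also have "(\<Prod>s\<in>y ` {..<n}. [:- s, 1:]) = \<pi> y"
        unfolding \<pi>_def using inj by (simp add: prod.reindex)
      also have "(\<Prod>s\<in>(if even d then {0} else {}). [:- s, 1:]) = E"
        by (auto simp: E_def e_def monom_Suc monom_0)
      finally show ?thesis by (simp add: mult.commute)
    qed
    have P_other: "poly (P i) (y j) = 0" if "i < n" "j < n" "i \<noteq> j" for i j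
      using that by (auto simp: P_def poly_prod)
    have P_own: "poly (P i) (y i) \<noteq> 0" if "i < n" for i
      using that inj by (auto simp: P_def poly_prod inj_on_def)
    have deg_P: "degree (P i) = n - 1" if "i < n" for i
      unfolding P_def using that by (subst degree_prod_linear) auto
    have orth: "(\<integral>x. poly (\<Prod>s\<in>S. [:- s, 1:]) x * poly q x \<partial>F) = 0" if q: "degree q + l \<le> d" for q
    proof -
      define r where "r = (\<Sum>i<n. smult (poly q (y i) / poly (P i) (y i)) (P i))"
      have "q = r"
      proof (rule poly_eqI_degree[where A = "y ` {..<n}"])
        fix x assume "x \<in> y ` {..<n}"
        then obtain j where j: "j < n" "x = y j" by auto
        have "poly r x = (\<Sum>i<n. if i = j then poly q (y j) else 0)"
          unfolding r_def poly_sum using P_other P_own j by (intro sum.cong) auto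
        with j show "poly q x = poly r x" by simp
      next
        have "degree r \<le> n - 1"
          unfolding r_def using deg_P by (intro degree_sum_le) (auto intro: order.trans[OF degree_smult_le])
        with n(1) q n(2,3) show "degree q < card (y ` {..<n})" "degree r < card (y ` {..<n})"
          using inj by (auto simp: card_image)
      qed
      have "(\<integral>x. poly (\<Prod>s\<in>S. [:- s, 1:]) x * poly q x \<partial>F) = L (E * \<pi> y * r)"
      proof -
        have "poly (E * \<pi> y * r) = (\<lambda>x. poly (E * \<pi> y) x * poly r x)"
          by auto
        then show ?thesis unfolding N L_def \<open>q = r\<close> by simp
      qed
      also have "E * \<pi> y * r = (\<Sum>i<n. smult (poly q (y i) / poly (P i) (y i)) (E * \<pi> y * P i))"
        unfolding r_def by (simp add: sum_distrib_left)
      also have "L \<dots> = (\<Sum>i<n. L (smult (poly q (y i) / poly (P i) (y i)) (E * \<pi> y * P i)))"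
        unfolding L_def poly_sum using int by (intro Bochner_Integration.integral_sum)
      also have "\<dots> = 0"
        using stat by (simp add: L_smult)
      finally show ?thesis .
    qed
    show ?thesis
    proof (rule lower_dist_of_quadrature[OF F _ card_S _ _ orth _ m M0])
      fix s assume "s \<in> S"
      then consider (node) i where "i < n" "s = y i" | (zero) "even d" "s = 0"
        by (auto simp: S_def split: if_splits)
      then show "\<exists>T. degree T \<le> d \<and> 0 < poly T s \<and> (\<forall>r\<in>S - {s}. poly T r = 0)
          \<and> (\<forall>x\<in>{0..1}. 0 \<le> poly T x)"
      proof cases
        case node
        have "degree (E * (P i)\<^sup>2) \<le> e + 2 * (n - 1)"
          using deg_P[OF node(1)]
          by (intro order.trans[OF degree_mult_le] add_mono order.trans[OF degree_power_le])
             (auto simp: E_def degree_monom_eq)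
        then have "degree (E * (P i)\<^sup>2) \<le> d"
          using n by linarith
        moreover have "0 < poly (E * (P i)\<^sup>2) s"
          using node P_own y_pos by (simp add: E_def poly_monom poly_power)
        moreover have "poly (E * (P i)\<^sup>2) r = 0" if "r \<in> S - {s}" for r
          using that node P_other[of i]
          by (auto simp: S_def E_def poly_monom poly_power e_def split: if_splits)
        ultimately show ?thesis
          using nn by (intro exI[of _ "E * (P i)\<^sup>2"]) auto
      next
        case zero
        have "degree ((\<pi> y)\<^sup>2) \<le> d"
          using n(3) zero by (intro order.trans[OF degree_power_le]) (simp add: \<pi>_def degree_prod_linear e_def)
        moreover have "0 < poly ((\<pi> y)\<^sup>2) s"
          using y_pos zero by (force simp: poly_power \<pi>_def poly_prod)
        moreover have "poly ((\<pi> y)\<^sup>2) r = 0" if "r \<in> S - {s}" for r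
          using that zero by (auto simp: S_def poly_power \<pi>_def poly_prod)
        ultimately show ?thesis
          by (intro exI[of _ "(\<pi> y)\<^sup>2"]) (auto simp: poly_power)
      qed
    qed (use y n d in \<open>auto simp: S_def\<close>)
  qed
qed

theorem lemma2:
  fixes d l :: nat and M :: "nat \<Rightarrow> real" and \<mu> :: real
  assumes "d \<ge> 1"
    and "moment_class d M \<noteq> {}"
    and "\<mu> \<in> {0..<1}"
    and "M 0 = 1"
    and "l = nat \<lceil>(real d + 1) / 2\<rceil>"
  shows "(\<exists>!F. is_lower_dist d l M F) \<and>
    (SUP F\<in>moment_class d M. D_min F \<mu> - D_min_moments d M \<mu>) =
      (SUP F\<in>moment_class d M. D_min F \<mu>) - D_min_moments d M \<mu> \<and>
    (\<forall>F\<^sub>0. is_lower_dist d l M F\<^sub>0 \<longrightarrow>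
      F\<^sub>0 \<in> moment_class d M \<and>
      D_min F\<^sub>0 \<mu> - D_min_moments d M \<mu> =
        (SUP F\<in>moment_class d M. D_min F \<mu> - D_min_moments d M \<mu>) \<and>
      D_min F\<^sub>0 \<mu> = (SUP F\<in>moment_class d M. D_min F \<mu>))"
proof -
  have l: "l = d div 2 + 1"
  proof (cases "even d")
    case True
    then obtain k where k: "d = 2 * k" by (elim evenE)
    have "\<lceil>(real d + 1) / 2\<rceil> = int k + 1"
      by (rule ceiling_unique) (auto simp: k)
    with assms(5) k show ?thesis by simp
  next
    case False
    then obtain k where k: "d = 2 * k + 1" by (elim oddE)
    have "\<lceil>(real d + 1) / 2\<rceil> = int k + 1"
      by (rule ceiling_unique) (auto simp: k)
    with assms(5) k show ?thesis by simp
  qed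
  have \<mu>: "0 \<le> \<mu>" "\<mu> < 1" using assms(3) by auto
  have mom: "F \<in> unit_dists \<and> (\<integral>x. x ^ m \<partial>F) = M m" if "F \<in> moment_class d M" "m \<le> d" for F m
  proof -
    have F: "F \<in> unit_dists" using that by (simp add: moment_class_def)
    interpret prob_space F using unit_distsD[OF F] by simp
    show ?thesis
      using that assms(4) F by (cases "m = 0") (auto simp: moment_class_def prob_space)
  qed
  have low: "F0 \<in> moment_class d M" if "is_lower_dist d l M F0" for F0
    using that lower_dist_moments[OF that] by (auto simp: moment_class_def is_lower_dist_def)
  have le: "D_min F \<mu> \<le> D_min F0 \<mu>" if "is_lower_dist d l M F0" "F \<in> moment_class d M" for F F0
    using that mom low[OF that(1)] \<mu>
    by (intro D_min_mono_moments lower_dist_moment_minimal[OF that(1) l]) auto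
  have sup: "D_min F0 \<mu> = (SUP F\<in>moment_class d M. D_min F \<mu>)"
    if "is_lower_dist d l M F0" for F0
    using low[OF that] le[OF that] by (auto intro!: antisym SUP_upper SUP_least)
  have sup_diff: "D_min F0 \<mu> - c = (SUP F\<in>moment_class d M. D_min F \<mu> - c)"
    if "is_lower_dist d l M F0" for F0 c
    using low[OF that] le[OF that]
    by (auto intro!: antisym SUP_upper SUP_least ereal_minus_mono)
  obtain F where "F \<in> moment_class d M" using assms(2) by auto
  then have "\<exists>F0. is_lower_dist d l M F0"
    using mom by (intro ex_lower_dist[of F d l M] assms(1,4) l) auto
  then obtain F0 where F0: "is_lower_dist d l M F0" ..
  then have "\<exists>!F. is_lower_dist d l M F"
    using lower_dist_unique[OF _ _ l] by blast
  moreover have "(SUP F\<in>moment_class d M. D_min F \<mu> - D_min_moments d M \<mu>) =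
      (SUP F\<in>moment_class d M. D_min F \<mu>) - D_min_moments d M \<mu>"
    using sup[OF F0] sup_diff[OF F0] by simp
  ultimately show ?thesis
    using low sup sup_diff by (intro conjI allI impI)
qed

end
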